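(* Assume that the field $\mathbb{F}$ has characteristic $2$. Let $\alpha$ and $\beta$ be elements of $\mathbb{F}$, set $p(t):=t^2-\alpha$ and $q(t):=t^2-\beta$, and assume that both $p$ and $q$ are irreducible over $\mathbb{F}$ and that they have distinct splitting fields in $\overline{\mathbb{F}}$. Let $u$ be an endomorphism of a finite-dimensional vector space $V$ over $\mathbb{F}$. Then, the following conditions are equivalent: (i) $u$ is a d-exceptional $(p,q)$-difference. (ii) Every invariant factor of $u$ is a power of $t^2-\alpha-\beta$, and if we denote by $r_1,\dots,r_k,\dots$ those invariant factors we have $r_{2k-1}=r_{2k}$ for all $k\geq 1$. (iii) In some basis of $V$, the endomorphism $u$ is represented by a block-diagonal matrix in which every diagonal block equals $C\bigl((t^2-\alpha-\beta)^n\bigr)\oplus C\bigl((t^2-\alpha-\beta)^n\bigr)$ for some positive integer $n$.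
   Context: $\overline{\mathbb{F}}$ is an algebraic closure of $\mathbb{F}$, and $\operatorname{Root}(p)$ is the set of roots of $p$ in $\overline{\mathbb{F}}$. An endomorphism $u$ of $V$ is a $(p,q)$-difference if $u=a-b$ for some endomorphisms $a,b$ of $V$ with $p(a)=0$ and $q(b)=0$. It is d-exceptional with respect to $(p,q)$ if all its eigenvalues in $\overline{\mathbb{F}}$ belong to $\operatorname{Root}(p)-\operatorname{Root}(q)=\{x-y: x\in\operatorname{Root}(p),\,y\in\operatorname{Root}(q)\}$; a d-exceptional $(p,q)$-difference is a $(p,q)$-difference that is d-exceptional with respect to $(p,q)$. $C(r)$ is the companion matrix of the monic polynomial $r$, and $\oplus$ is block-diagonal sum. The invariant factors of $u$ are the monic polynomials $r_1,r_2,\dots$ with $r_{i+1}\mid r_i$ such that $u$ is represented in some basis by $C(r_1)\oplus C(r_2)\oplus\cdots$ ($C(1)$ being the $0\times 0$ matrix); the finite list of nonconstant ones is extended to an infinite sequence by $r_i=1$. *)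

theory Defs
  imports
    "HOL-Algebra.Algebraic_Closure_Type"
    "HOL-Algebra.Generated_Fields"
    "Jordan_Normal_Form.Char_Poly"
begin

text \<open>
  A vector space over the field \<open>'a\<close> is given by its scalar multiplication
  \<open>scale :: 'a \<Rightarrow> 'b \<Rightarrow> 'b\<close>, as in the locale \<open>vector_space\<close>; the underlying set is the whole
  type \<open>'b\<close>, and endomorphisms are the maps \<open>u\<close> with \<open>Vector_Spaces.linear scale scale u\<close>.
\<close>

definition poly_endo ::
  "('a::field \<Rightarrow> 'b::ab_group_add \<Rightarrow> 'b) \<Rightarrow> 'a poly \<Rightarrow> ('b \<Rightarrow> 'b) \<Rightarrow> 'b \<Rightarrow> 'b" where
  "poly_endo scale p f = (\<lambda>v. \<Sum>i\<le>degree p. scale (coeff p i) ((f ^^ i) v))"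

definition ordered_basis ::
  "('a::field \<Rightarrow> 'b::ab_group_add \<Rightarrow> 'b) \<Rightarrow> 'b list \<Rightarrow> bool" where
  "ordered_basis scale bs \<longleftrightarrow>
     distinct bs \<and> \<not> module.dependent scale (set bs) \<and> module.span scale (set bs) = UNIV"

text \<open>Column \<open>j\<close> of the matrix holds the coordinates of the image of the \<open>j\<close>-th basis vector.\<close>

definition represents ::
  "('a::field \<Rightarrow> 'b::ab_group_add \<Rightarrow> 'b) \<Rightarrow> ('b \<Rightarrow> 'b) \<Rightarrow> 'b list \<Rightarrow> 'a mat \<Rightarrow> bool" where
  "represents scale u bs M \<longleftrightarrow>
     ordered_basis scale bs \<and> M \<in> carrier_mat (length bs) (length bs) \<and>
     (\<forall>j<length bs. u (bs ! j) = (\<Sum>i<length bs. scale (M $$ (i, j)) (bs ! i)))"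

definition Root :: "'a::field poly \<Rightarrow> 'a alg_closure set" where
  "Root p = {x. poly (map_poly to_ac p) x = 0}"

definition splitting_field :: "'a::field poly \<Rightarrow> 'a alg_closure set" where
  "splitting_field p = generate_field ring_of_type_algebra (range to_ac \<union> Root p)"

definition pq_difference ::
  "('a::field \<Rightarrow> 'b::ab_group_add \<Rightarrow> 'b) \<Rightarrow> 'a poly \<Rightarrow> 'a poly \<Rightarrow> ('b \<Rightarrow> 'b) \<Rightarrow> bool" where
  "pq_difference scale p q u \<longleftrightarrow>
     (\<exists>a b. Vector_Spaces.linear scale scale a \<and> Vector_Spaces.linear scale scale b \<and>
        poly_endo scale p a = (\<lambda>v. 0) \<and> poly_endo scale q b = (\<lambda>v. 0) \<and>
        u = (\<lambda>v. a v - b v))"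

text \<open>
  The eigenvalues in the algebraic closure are those of the extension of scalars of \<open>u\<close>, that is, of
  any matrix of \<open>u\<close> read over the algebraic closure.
\<close>

definition ac_eigenvalue ::
  "('a::field \<Rightarrow> 'b::ab_group_add \<Rightarrow> 'b) \<Rightarrow> ('b \<Rightarrow> 'b) \<Rightarrow> 'a alg_closure \<Rightarrow> bool" where
  "ac_eigenvalue scale u x \<longleftrightarrow>
     (\<exists>bs M. represents scale u bs M \<and> eigenvalue (map_mat to_ac M) x)"

definition d_exceptional ::
  "('a::field \<Rightarrow> 'b::ab_group_add \<Rightarrow> 'b) \<Rightarrow> 'a poly \<Rightarrow> 'a poly \<Rightarrow> ('b \<Rightarrow> 'b) \<Rightarrow> bool" where
  "d_exceptional scale p q u \<longleftrightarrow>
     (\<forall>x. ac_eigenvalue scale u x \<longrightarrow> x \<in> {y - z | y z. y \<in> Root p \<and> z \<in> Root q})"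

definition companion :: "'a::field poly \<Rightarrow> 'a mat" where
  "companion r = mat (degree r) (degree r)
     (\<lambda>(i, j). if j = degree r - 1 then - coeff r i else if i = j + 1 then 1 else 0)"

text \<open>
  The sequence of invariant factors is indexed from \<open>1\<close>; the value \<open>r 0\<close> is irrelevant.  The bound
  \<open>N\<close> may exceed the number of nonconstant factors, since \<open>companion 1\<close> is the \<open>0 \<times> 0\<close> matrix.
\<close>

definition invariant_factors ::
  "('a::field \<Rightarrow> 'b::ab_group_add \<Rightarrow> 'b) \<Rightarrow> ('b \<Rightarrow> 'b) \<Rightarrow> (nat \<Rightarrow> 'a poly) \<Rightarrow> bool" where
  "invariant_factors scale u r \<longleftrightarrow>
     (\<forall>i\<ge>1. lead_coeff (r i) = 1 \<and> r (i + 1) dvd r i) \<and>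
     (\<exists>N bs. (\<forall>i>N. r i = 1) \<and>
        represents scale u bs (diag_block_mat (map (\<lambda>i. companion (r i)) [1..<Suc N])))"

end

(*
  Put w = P(u). If u = a - b with a^2 = alpha and b^2 = beta, then w = ab + ba commutes with a and
  a u = u a + w, and u is d-exceptional exactly when w is nilpotent. Modulo w the algebra generated
  by u and a is commutative, and the hypothesis on the splitting fields makes it the field
  F(sqrt alpha, sqrt (alpha + beta)) of degree 4: every element squares to a value of the form
  c0^2 + gamma c1^2 + alpha (c2^2 + gamma c3^2), gamma = alpha + beta, which is anisotropic. Hence the
  classical structure theorem for nilpotent operators goes through over the algebra generated by u
  and a, and each indecomposable summand is generated over F[u] by a pair x, a x with the same
  annihilator P^n. Conversely, on such pairs an operator a with these relations is written down
  using the derivation f -> P f' of F[t], whose square is zero because P' = 0 and f'' = 0.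
*)
theory Submission
  imports Defs "HOL-Library.Function_Algebras"
begin

section \<open>Polynomials acting through an endomorphism\<close>

text \<open>The obstacle is that \<open>u\<close> and \<open>a\<close> need not commute, so the
  usual theory over a principal ideal domain does not apply to the algebra they generate. What saves
  the argument is that P(u) commutes with both operators, since P' = 0: its kernel and its image are
  stable under \<open>u\<close> and \<open>a\<close>. The induction on the nilpotency exponent then
  needs inverses only on the kernel, and there they are explicit, because g(u) + h(u) a squares to a
  scalar. So no extension field is constructed; its only trace is the assumption
  \<open>norm_eq_0\<close>. The role of P comes from u^2 = a^2 + b^2 - (a b + b a), which in
  characteristic 2 reads P(u) = a b + b a. Squaring is injective in characteristic 2, so \<alpha> +
  \<beta> has exactly one square root in the algebraic closure; it is the only eigenvalue that a
  d-exceptional \<open>u\<close> can have, and P is the square of a linear factor there. Companion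
  matrices are traded for decompositions into cyclic F[t]-modules, and extension of scalars for
  functionals with values in the algebraic closure.\<close>

lemma poly_endo_eq_sum:
  assumes "Modules.module scale" "degree p \<le> n"
  shows "poly_endo scale p f v = (\<Sum>i\<le>n. scale (coeff p i) ((f ^^ i) v))"
proof -
  interpret Modules.module scale by fact
  show ?thesis
    unfolding poly_endo_def using assms(2)
    by (intro sum.mono_neutral_left) (auto simp: coeff_eq_0)
qed

text \<open>Kept general because it is instantiated three times: for \<open>u\<close>, for the
  square roots \<open>a\<close> and \<open>b\<close>, and for composition with \<open>u\<close> on
  functions into the algebraic closure.\<close>

locale linear_endo = vector_space scale
  for scale :: "'a::field \<Rightarrow> 'b::ab_group_add \<Rightarrow> 'b" +
  fixes u :: "'b \<Rightarrow> 'b"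
  assumes linear_u: "Vector_Spaces.linear scale scale u"
begin

abbreviation act :: "'a poly \<Rightarrow> 'b \<Rightarrow> 'b" where
  "act f v \<equiv> poly_endo scale f u v"

sublocale endo: Vector_Spaces.linear scale scale u
  by (fact linear_u)

lemma act_eq_sum: "degree f \<le> n \<Longrightarrow> act f v = (\<Sum>i\<le>n. scale (coeff f i) ((u ^^ i) v))"
  by (rule poly_endo_eq_sum[OF module_axioms])

lemma act_0 [simp]: "act 0 v = 0"
  by (simp add: poly_endo_def)

lemma act_pCons: "act (pCons c f) v = scale c v + u (act f v)"
proof -
  have "act (pCons c f) v = (\<Sum>i\<le>Suc (degree f). scale (coeff (pCons c f) i) ((u ^^ i) v))"
    by (rule act_eq_sum) (simp add: degree_pCons_le)
  also have "\<dots> = scale c v + (\<Sum>i\<le>degree f. scale (coeff f i) ((u ^^ Suc i) v))"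
    by (subst sum.atMost_Suc_shift) simp
  also have "(\<Sum>i\<le>degree f. scale (coeff f i) ((u ^^ Suc i) v)) = u (act f v)"
    by (simp add: poly_endo_def endo.sum endo.scale)
  finally show ?thesis .
qed

lemma act_const: "act [:c:] v = scale c v"
  using act_pCons[of c 0 v] by (simp add: endo.zero)

lemma act_1 [simp]: "act 1 v = v"
  using act_const[of 1 v] by (simp add: one_pCons)

lemma act_add: "act (f + g) v = act f v + act g v"
proof -
  let ?n = "max (degree f) (degree g)"
  have "act (f + g) v = (\<Sum>i\<le>?n. scale (coeff (f + g) i) ((u ^^ i) v))"
    by (rule act_eq_sum) (simp add: degree_add_le)
  also have "\<dots> = act f v + act g v"
    by (simp add: act_eq_sum[of f ?n] act_eq_sum[of g ?n] scale_left_distrib sum.distrib)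
  finally show ?thesis .
qed

lemma act_smult: "act (Polynomial.smult c f) v = scale c (act f v)"
proof -
  have "act (Polynomial.smult c f) v = (\<Sum>i\<le>degree f. scale (coeff (Polynomial.smult c f) i) ((u ^^ i) v))"
    by (rule act_eq_sum) (simp add: degree_smult_le)
  then show ?thesis
    by (simp add: poly_endo_def scale_sum_right)
qed

lemma act_minus: "act (- f) v = - act f v"
  using act_smult[of "- 1" f v] by simp

lemma act_diff: "act (f - g) v = act f v - act g v"
  using act_add[of f "- g" v] by (simp add: act_minus)

lemma act_sum: "act (\<Sum>i\<in>I. f i) v = (\<Sum>i\<in>I. act (f i) v)"
  by (induction I rule: infinite_finite_induct) (auto simp: act_add)

lemma act_mult: "act (f * g) v = act f (act g v)"
  by (induction f) (auto simp: act_pCons act_add act_smult mult_pCons_left)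

lemma act_monom: "act (Polynomial.monom c j) v = scale c ((u ^^ j) v)"
  by (induction j) (auto simp: monom_0 act_const monom_Suc act_pCons endo.scale)

lemma act_linear: "Vector_Spaces.linear scale scale (act f)"
proof -
  have "act f (x + y) = act f x + act f y \<and> act f (scale c x) = scale c (act f x)" for x y c
    by (induction f) (auto simp: act_pCons endo.add endo.scale scale_right_distrib ac_simps)
  then show ?thesis
    by (intro Vector_Spaces.linear.intro module_hom.intro module_hom_axioms.intro
        vector_space_axioms module_axioms) auto
qed

lemmas act_add_right = module_hom.add[OF act_linear[THEN Vector_Spaces.linear.axioms(3)]]
  and act_scale_right = module_hom.scale[OF act_linear[THEN Vector_Spaces.linear.axioms(3)]]
  and act_zero_right [simp] = module_hom.zero[OF act_linear[THEN Vector_Spaces.linear.axioms(3)]]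
  and act_diff_right = module_hom.diff[OF act_linear[THEN Vector_Spaces.linear.axioms(3)]]
  and act_sum_right = module_hom.sum[OF act_linear[THEN Vector_Spaces.linear.axioms(3)]]

lemma act_commute: "act f (act g v) = act g (act f v)"
  by (metis act_mult mult.commute)

lemma act_X [simp]: "act [:0, 1:] v = u v"
  by (simp add: act_pCons endo.zero)

lemma act_dvd_eq_0: "g dvd f \<Longrightarrow> act g v = 0 \<Longrightarrow> act f v = 0"
  by (metis act_mult act_zero_right dvd_def mult.commute)

lemma subspace_act:
  assumes "subspace W" "\<And>x. x \<in> W \<Longrightarrow> u x \<in> W" "x \<in> W"
  shows "act f x \<in> W"
  by (induction f) (auto simp: act_pCons assms subspace_0 subspace_add subspace_scale)

end

section \<open>Companion matrices and cyclic decompositions\<close>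

context vector_space
begin

text \<open>Independence of the image set does not see repetitions in the family. Injectivity
  accounts for them: a repeated vector gives the relation with coefficients 1 and -1.\<close>

lemma independent_family_iff:
  assumes "finite I"
  shows "inj_on F I \<and> independent (F ` I) \<longleftrightarrow>
    (\<forall>c. (\<Sum>k\<in>I. scale (c k) (F k)) = 0 \<longrightarrow> (\<forall>k\<in>I. c k = 0))"
proof (intro iffI conjI allI impI ballI; (elim conjE)?)
  fix c k
  assume inj: "inj_on F I" and ind: "independent (F ` I)"
    and c: "(\<Sum>k\<in>I. scale (c k) (F k)) = 0" and k: "k \<in> I"
  let ?c = "\<lambda>y. c (inv_into I F y)"
  have "(\<Sum>y\<in>F ` I. scale (?c y) y) = 0"
    using c by (simp add: sum.reindex[OF inj] inv_into_f_f[OF inj])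
  then have "?c (F k) = 0"
    using independentD[OF ind finite_imageI[OF assms] subset_refl, of ?c "F k"] k by simp
  then show "c k = 0"
    using k by (simp add: inv_into_f_f[OF inj])
next
  assume c0: "\<forall>c. (\<Sum>k\<in>I. scale (c k) (F k)) = 0 \<longrightarrow> (\<forall>k\<in>I. c k = 0)"
  show inj: "inj_on F I"
  proof (rule inj_onI, rule ccontr)
    fix k l
    assume kl: "k \<in> I" "l \<in> I" "F k = F l" "k \<noteq> l"
    let ?c = "\<lambda>i. if i = k then 1 else if i = l then - 1 else (0 :: 'a)"
    have "(\<Sum>i\<in>I. scale (?c i) (F i)) =
        (\<Sum>i\<in>I. (if i = k then F k else 0) + (if i = l then - F l else 0))"
      using kl by (intro sum.cong) auto
    also have "\<dots> = 0"
      using kl assms by (simp add: sum.distrib)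
    finally have "?c k = 0"
      using c0[rule_format, of ?c k] kl(1) by blast
    then show False by simp
  qed
  show "independent (F ` I)"
  proof
    assume "dependent (F ` I)"
    then obtain c y where y: "y \<in> F ` I" "c y \<noteq> 0"
      and c: "(\<Sum>y\<in>F ` I. scale (c y) y) = 0"
      unfolding dependent_finite[OF finite_imageI[OF assms]] by blast
    have "(\<Sum>k\<in>I. scale (c (F k)) (F k)) = 0"
      using c by (simp add: sum.reindex[OF inj])
    then have "\<forall>k\<in>I. c (F k) = 0"
      using c0 by (auto dest: spec[of _ "\<lambda>k. c (F k)"])
    with y show False by auto
  qed
qed

lemma independent_family_le_card:
  assumes ind: "\<And>c i. (\<Sum>i<m. scale (c i) (x i)) = 0 \<Longrightarrow> i < m \<Longrightarrow> c i = 0"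
    and B: "finite B" "span B = UNIV"
  shows "m \<le> card B"
proof -
  have "inj_on x {..<m} \<and> independent (x ` {..<m})"
    unfolding independent_family_iff[OF finite_lessThan] using ind by blast
  then show ?thesis
    using independent_span_bound[OF B(1), of "x ` {..<m}"] B(2) by (simp add: card_image)
qed

text \<open>Allows the basis vectors to be indexed by pairs (summand, power of \<open>u\<close>), as
  the Krylov vectors are further below.\<close>

lemma ordered_basis_map_iff:
  assumes "distinct ks"
  shows "ordered_basis scale (map F ks) \<longleftrightarrow>
    (\<forall>x. \<exists>c. x = (\<Sum>k\<in>set ks. scale (c k) (F k))) \<and>
    (\<forall>c. (\<Sum>k\<in>set ks. scale (c k) (F k)) = 0 \<longrightarrow> (\<forall>k\<in>set ks. c k = 0))"
proof -
  have "(\<exists>c. x = (\<Sum>k\<in>set ks. scale (c k) (F k))) \<longleftrightarrow> x \<in> span (F ` set ks)"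
    if inj: "inj_on F (set ks)" for x
  proof
    assume "x \<in> span (F ` set ks)"
    then obtain c where "x = (\<Sum>y\<in>F ` set ks. scale (c y) y)"
      unfolding span_finite[OF finite_imageI[OF finite_set]] by blast
    then have "x = (\<Sum>k\<in>set ks. scale (c (F k)) (F k))"
      by (simp add: sum.reindex[OF inj])
    then show "\<exists>c. x = (\<Sum>k\<in>set ks. scale (c k) (F k))"
      by (intro exI[of _ "\<lambda>k. c (F k)"])
  qed (auto intro!: span_sum span_scale intro: span_base)
  then show ?thesis
    unfolding independent_family_iff[OF finite_set, symmetric] ordered_basis_def
    using assms by (auto simp: distinct_map)
qed

end

text \<open>\<open>represents\<close> without the basis condition. Unlike the latter, this half can
  be checked block by block along a concatenation of lists.\<close>

definition matrix_action ::
  "('a::field \<Rightarrow> 'b::ab_group_add \<Rightarrow> 'b) \<Rightarrow> ('b \<Rightarrow> 'b) \<Rightarrow> 'b list \<Rightarrow> 'a mat \<Rightarrow> bool" where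
  "matrix_action scale u bs M \<longleftrightarrow> M \<in> carrier_mat (length bs) (length bs) \<and>
     (\<forall>j<length bs. u (bs ! j) = (\<Sum>i<length bs. scale (M $$ (i, j)) (bs ! i)))"

lemma represents_iff:
  "represents scale u bs M \<longleftrightarrow> ordered_basis scale bs \<and> matrix_action scale u bs M"
  by (auto simp: represents_def matrix_action_def)

lemma sum_lessThan_add:
  fixes f :: "nat \<Rightarrow> 'c::comm_monoid_add"
  shows "(\<Sum>i<m + n. f i) = (\<Sum>i<m. f i) + (\<Sum>i<n. f (m + i))"
  by (induction n) (auto simp: ac_simps)

lemma (in vector_space) matrix_action_four_block:
  assumes A: "A \<in> carrier_mat (length bs) (length bs)"
    and D: "D \<in> carrier_mat (length cs) (length cs)"
  shows "matrix_action scale u (bs @ cs)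
      (four_block_mat A (0\<^sub>m (length bs) (length cs)) (0\<^sub>m (length cs) (length bs)) D) \<longleftrightarrow>
    matrix_action scale u bs A \<and> matrix_action scale u cs D"
proof -
  define M where
    "M = four_block_mat A (0\<^sub>m (length bs) (length cs)) (0\<^sub>m (length cs) (length bs)) D"
  have M: "M \<in> carrier_mat (length bs + length cs) (length bs + length cs)"
    unfolding M_def using A D by (rule four_block_carrier_mat)
  have left: "(\<Sum>i<length bs + length cs. scale (M $$ (i, j)) ((bs @ cs) ! i)) =
      (\<Sum>i<length bs. scale (A $$ (i, j)) (bs ! i))" if "j < length bs" for j
    using that A D by (simp add: sum_lessThan_add nth_append M_def)
  have right: "(\<Sum>i<length bs + length cs. scale (M $$ (i, length bs + j)) ((bs @ cs) ! i)) =
      (\<Sum>i<length cs. scale (D $$ (i, j)) (cs ! i))" if "j < length cs" for j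
    using that A D by (simp add: sum_lessThan_add nth_append M_def)
  have split: "(\<forall>j<length bs + length cs. Q j) \<longleftrightarrow>
      (\<forall>j<length bs. Q j) \<and> (\<forall>j<length cs. Q (length bs + j))" for Q
  proof (intro iffI conjI allI impI; (elim conjE)?)
    fix j
    assume "\<forall>j<length bs. Q j" "\<forall>j<length cs. Q (length bs + j)" "j < length bs + length cs"
    then show "Q j"
      by (cases "j < length bs") (auto dest: spec[of _ "j - length bs"])
  qed auto
  show ?thesis
    unfolding matrix_action_def length_append split M_def[symmetric]
    using A D M by (simp add: left right) (simp add: nth_append)
qed

section \<open>Companion blocks and cyclic modules\<close>

context linear_endo
begin

definition krylov :: "'b \<Rightarrow> nat \<Rightarrow> 'b list" where
  "krylov v d = map (\<lambda>j. (u ^^ j) v) [0..<d]"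

lemma act_monic:
  assumes "lead_coeff r = 1"
  shows "act r v = (\<Sum>i<degree r. scale (coeff r i) ((u ^^ i) v)) + (u ^^ degree r) v"
  using assms by (simp add: poly_endo_def lessThan_Suc_atMost[symmetric])

text \<open>All columns but the last say that \<open>u\<close> shifts along the list, so the list is
  determined by its first vector; the last column is then the equation
  \<open>act r v = 0\<close>.\<close>

lemma matrix_action_companion:
  assumes r: "lead_coeff r = 1"
  shows "matrix_action scale u bs (companion r) \<longleftrightarrow>
    (\<exists>v. bs = krylov v (degree r) \<and> act r v = 0)"
proof
  assume M: "matrix_action scale u bs (companion r)"
  then have "companion r \<in> carrier_mat (length bs) (length bs)"
    unfolding matrix_action_def by (rule conjunct1)
  then have "dim_row (companion r) = length bs"
    by (rule carrier_matD)
  then have len: "length bs = degree r"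
    by (simp add: companion_def)
  show "\<exists>v. bs = krylov v (degree r) \<and> act r v = 0"
  proof (cases "degree r = 0")
    case True
    \<comment> \<open>The list is empty and has no first vector. Here r = 1, and 0 is the only
      vector killed by it.\<close>
    then show ?thesis
      using len by (intro exI[of _ 0]) (auto simp: krylov_def)
  next
    case False
    have col: "u (bs ! j) = (\<Sum>i<degree r. scale (companion r $$ (i, j)) (bs ! i))"
      if "j < degree r" for j
      using M that len by (simp add: matrix_action_def)
    have step: "u (bs ! j) = bs ! Suc j" if "Suc j < degree r" for j
    proof -
      have "u (bs ! j) = (\<Sum>i<degree r. if i = Suc j then bs ! i else 0)"
        unfolding col[OF Suc_lessD[OF that]]
        using that by (intro sum.cong refl) (auto simp: companion_def)
      then show ?thesis
        using that by simp
    qed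
    have pow: "bs ! j = (u ^^ j) (bs ! 0)" if "j < degree r" for j
      using that by (induction j) (auto simp: step[symmetric])
    obtain d where d: "degree r = Suc d"
      using False not0_implies_Suc by blast
    have "(u ^^ degree r) (bs ! 0) = u (bs ! d)"
      using pow[of d] d by simp
    also have "\<dots> = (\<Sum>i<degree r. scale (- coeff r i) (bs ! i))"
      using d by (subst col, simp, intro sum.cong refl) (auto simp: companion_def)
    also have "\<dots> = (\<Sum>i<degree r. scale (- coeff r i) ((u ^^ i) (bs ! 0)))"
      by (intro sum.cong refl arg_cong[where f = "scale _"] pow) simp
    also have "\<dots> = - (\<Sum>i<degree r. scale (coeff r i) ((u ^^ i) (bs ! 0)))"
      by (simp add: sum_negf)
    finally have "act r (bs ! 0) = 0"
      by (simp add: act_monic[OF r])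
    moreover have "bs = krylov (bs ! 0) (degree r)"
    proof (rule nth_equalityI)
      fix i
      assume "i < length bs"
      then show "bs ! i = krylov (bs ! 0) (degree r) ! i"
        using pow[of i] len by (simp add: krylov_def)
    qed (simp add: krylov_def len)
    ultimately show ?thesis by blast
  qed
next
  assume "\<exists>v. bs = krylov v (degree r) \<and> act r v = 0"
  then obtain v where bs: "bs = krylov v (degree r)" and v: "act r v = 0"
    by blast
  have "u (bs ! j) = (\<Sum>i<degree r. scale (companion r $$ (i, j)) (bs ! i))"
    if j: "j < degree r" for j
  proof (cases "Suc j = degree r")
    case True
    have "bs ! j = (u ^^ j) v"
      using j by (simp add: bs krylov_def)
    then have "u (bs ! j) = (u ^^ degree r) v"
      by (simp flip: True)
    also have "\<dots> = (\<Sum>i<degree r. scale (- coeff r i) (bs ! i))"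
      using v by (simp add: act_monic[OF r] bs krylov_def sum_negf eq_neg_iff_add_eq_0 add.commute)
    also have "\<dots> = (\<Sum>i<degree r. scale (companion r $$ (i, j)) (bs ! i))"
      using True by (intro sum.cong refl) (auto simp: companion_def)
    finally show ?thesis .
  next
    case False
    have "(\<Sum>i<degree r. scale (companion r $$ (i, j)) (bs ! i)) =
        (\<Sum>i<degree r. if i = Suc j then bs ! i else 0)"
      using False j by (intro sum.cong refl) (auto simp: companion_def)
    also have "\<dots> = bs ! Suc j"
      using False j by simp
    finally show ?thesis
      using False j by (simp add: bs krylov_def)
  qed
  then show "matrix_action scale u bs (companion r)"
    by (simp add: matrix_action_def bs krylov_def companion_def)
qed

definition krylov_list :: "nat \<Rightarrow> (nat \<Rightarrow> 'b) \<Rightarrow> (nat \<Rightarrow> 'a poly) \<Rightarrow> 'b list" where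
  "krylov_list m v r = concat (map (\<lambda>k. krylov (v k) (degree (r k))) [0..<m])"

lemma krylov_list_Suc:
  "krylov_list (Suc m) v r =
     krylov (v 0) (degree (r 0)) @ krylov_list m (\<lambda>k. v (Suc k)) (\<lambda>k. r (Suc k))"
proof -
  have "[0..<Suc m] = 0 # map Suc [0..<m]"
    by (simp add: map_Suc_upt upt_conv_Cons)
  then show ?thesis
    by (simp add: krylov_list_def comp_def)
qed

lemma matrix_action_companions:
  assumes "\<forall>r\<in>set rs. lead_coeff r = 1"
  shows "matrix_action scale u bs (diag_block_mat (map companion rs)) \<longleftrightarrow>
    (\<exists>v. bs = krylov_list (length rs) v ((!) rs) \<and> (\<forall>k<length rs. act (rs ! k) (v k) = 0))"
  using assms
proof (induction rs arbitrary: bs)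
  case Nil
  then show ?case
    by (auto simp: matrix_action_def krylov_list_def)
next
  case (Cons r rs)
  let ?D = "diag_block_mat (map companion rs)"
  let ?F = "diag_block_mat (map companion (r # rs))"
  have r: "lead_coeff r = 1" and rs: "\<forall>r\<in>set rs. lead_coeff r = 1"
    using Cons.prems by auto
  define l where "l = dim_row ?D"
  have D: "?D \<in> carrier_mat l l"
    unfolding l_def by (auto simp: dim_diag_block_mat companion_def comp_def)
  have C: "companion r \<in> carrier_mat (degree r) (degree r)"
    by (simp add: companion_def)
  have F: "?F = four_block_mat (companion r) (0\<^sub>m (degree r) l) (0\<^sub>m l (degree r)) ?D"
    using C D by (simp add: Let_def carrier_matD)
  have l: "length cs = l" if "matrix_action scale u cs ?D" for cs
    using that D by (auto simp: matrix_action_def)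
  have block: "matrix_action scale u (cs @ ds) ?F \<longleftrightarrow>
      matrix_action scale u cs (companion r) \<and> matrix_action scale u ds ?D"
    if "length cs = degree r" "length ds = l" for cs ds
    using matrix_action_four_block[of "companion r" cs ?D ds u] that C D F by simp
  show ?case
  proof
    assume A: "matrix_action scale u bs ?F"
    have "dim_row ?F = degree r + l"
      using C D by (simp add: F)
    then have len: "length bs = degree r + l"
      using A by (auto simp: matrix_action_def)
    define cs ds where "cs = take (degree r) bs" and "ds = drop (degree r) bs"
    have bs: "bs = cs @ ds" "length cs = degree r" "length ds = l"
      using len by (auto simp: cs_def ds_def)
    then have "matrix_action scale u cs (companion r)" "matrix_action scale u ds ?D"
      using A block by auto
    then obtain x v where "cs = krylov x (degree r)" "act r x = 0"
      "ds = krylov_list (length rs) v ((!) rs)" "\<forall>k<length rs. act (rs ! k) (v k) = 0"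
      unfolding matrix_action_companion[OF r] Cons.IH[OF rs] by blast
    then show "\<exists>v. bs = krylov_list (length (r # rs)) v ((!) (r # rs)) \<and>
        (\<forall>k<length (r # rs). act ((r # rs) ! k) (v k) = 0)"
      by (intro exI[of _ "case_nat x v"]) (auto simp: krylov_list_Suc bs split: nat.split)
  next
    assume "\<exists>v. bs = krylov_list (length (r # rs)) v ((!) (r # rs)) \<and>
        (\<forall>k<length (r # rs). act ((r # rs) ! k) (v k) = 0)"
    then obtain v where bs: "bs = krylov_list (length (r # rs)) v ((!) (r # rs))"
      and v: "\<And>k. k < length (r # rs) \<Longrightarrow> act ((r # rs) ! k) (v k) = 0"
      by blast
    let ?cs = "krylov (v 0) (degree r)"
    let ?ds = "krylov_list (length rs) (\<lambda>k. v (Suc k)) ((!) rs)"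
    have cs: "matrix_action scale u ?cs (companion r)"
      unfolding matrix_action_companion[OF r] using v[of 0] by auto
    have ds: "matrix_action scale u ?ds ?D"
      unfolding Cons.IH[OF rs] using v[of "Suc k" for k] by (intro exI[of _ "\<lambda>k. v (Suc k)"]) auto
    have "matrix_action scale u (?cs @ ?ds) ?F"
      using cs ds l[OF ds] by (subst block) (auto simp: krylov_def)
    then show "matrix_action scale u bs ?F"
      by (simp add: bs krylov_list_Suc)
  qed
qed

text \<open>An internal direct sum of cyclic F[t]-modules, the k-th one isomorphic to F[t]/(r k).
  The last clause says that all relations among the generators come from the \<open>r k\<close>. A
  factor 1 is allowed and stands for a zero summand.\<close>

definition cyclic_decomposition :: "'i set \<Rightarrow> ('i \<Rightarrow> 'b) \<Rightarrow> ('i \<Rightarrow> 'a poly) \<Rightarrow> bool" where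
  "cyclic_decomposition I v r \<longleftrightarrow>
     (\<forall>k\<in>I. act (r k) (v k) = 0) \<and>
     (\<forall>x. \<exists>f. x = (\<Sum>k\<in>I. act (f k) (v k))) \<and>
     (\<forall>f. (\<Sum>k\<in>I. act (f k) (v k)) = 0 \<longrightarrow> (\<forall>k\<in>I. r k dvd f k))"

lemma act_mod:
  assumes "act r x = 0"
  shows "act (f mod r) x = act f x"
proof -
  have "act f x = act (f div r * r + f mod r) x"
    by simp
  also have "\<dots> = act (f mod r) x"
    unfolding act_add act_mult assms by simp
  finally show ?thesis ..
qed

lemma poly_eq_sum_monoms_degree_less:
  "degree f < d \<or> f = 0 \<Longrightarrow> (\<Sum>j<d. Polynomial.monom (coeff f j) j) = f"
  using poly_as_sum_of_monoms'[of f "d - 1"]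
  by (cases d) (auto simp: lessThan_Suc_atMost)

text \<open>Reducing the k-th coefficient modulo \<open>r k\<close> does not change a combination of
  the generators, and a reduced polynomial is the same as its list of \<open>degree (r k)\<close>
  coefficients. Hence linear combinations of Krylov vectors and polynomial combinations of
  generators correspond.\<close>

lemma ordered_basis_krylov_list_iff:
  assumes r: "\<And>k. k < m \<Longrightarrow> lead_coeff (r k) = 1"
    and v: "\<And>k. k < m \<Longrightarrow> act (r k) (v k) = 0"
  shows "ordered_basis scale (krylov_list m v r) \<longleftrightarrow> cyclic_decomposition {..<m} v r"
proof -
  define ks where "ks = concat (map (\<lambda>k. map (Pair k) [0..<degree (r k)]) [0..<m])"
  define F where "F = (\<lambda>(k, j). (u ^^ j) (v k))"
  have "distinct ks"
    unfolding ks_def by (induction m) (auto simp: distinct_map inj_on_def)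
  have set_ks: "set ks = Sigma {..<m} (\<lambda>k. {..<degree (r k)})"
    by (auto simp: ks_def)
  have kl: "krylov_list m v r = map F ks"
    by (simp add: krylov_list_def ks_def F_def krylov_def map_concat comp_def)
  define pol where "pol = (\<lambda>(c :: nat \<times> nat \<Rightarrow> 'a) k. \<Sum>j<degree (r k). Polynomial.monom (c (k, j)) j)"
  have sum_eq: "(\<Sum>k\<in>set ks. scale (c k) (F k)) = (\<Sum>k<m. act (pol c k) (v k))" for c
  proof -
    have "(\<Sum>k\<in>set ks. scale (c k) (F k)) =
        (\<Sum>k<m. \<Sum>j<degree (r k). scale (c (k, j)) ((u ^^ j) (v k)))"
      unfolding set_ks F_def by (subst sum.Sigma) (auto intro!: sum.cong)
    then show ?thesis
      by (simp add: pol_def act_sum act_monom)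
  qed
  have coeff_pol: "coeff (pol c k) j = (if j < degree (r k) then c (k, j) else 0)" for c k j
    unfolding pol_def coeff_sum coeff_monom by (simp add: sum.delta)
  have pol_mod: "pol (\<lambda>(k, j). coeff (f k mod r k) j) k = f k mod r k" if "k < m" for f k
  proof -
    have "r k \<noteq> 0"
      using r[OF that] by auto
    then have "degree (f k mod r k) < degree (r k) \<or> f k mod r k = 0"
      using degree_mod_less by blast
    then show ?thesis
      unfolding pol_def by (simp add: poly_eq_sum_monoms_degree_less)
  qed
  have reduce: "(\<Sum>k\<in>set ks. scale ((\<lambda>(k, j). coeff (f k mod r k) j) k) (F k)) =
      (\<Sum>k<m. act (f k) (v k))" for f
    unfolding sum_eq by (intro sum.cong) (auto simp: pol_mod act_mod v)
  have "(\<exists>c. x = (\<Sum>k\<in>set ks. scale (c k) (F k))) \<longleftrightarrow>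
      (\<exists>f. x = (\<Sum>k<m. act (f k) (v k)))" for x
    using sum_eq reduce by metis
  moreover have "(\<forall>c. (\<Sum>k\<in>set ks. scale (c k) (F k)) = 0 \<longrightarrow> (\<forall>k\<in>set ks. c k = 0)) \<longleftrightarrow>
      (\<forall>f. (\<Sum>k<m. act (f k) (v k)) = 0 \<longrightarrow> (\<forall>k\<in>{..<m}. r k dvd f k))" (is "?L \<longleftrightarrow> ?R")
  proof
    assume L: ?L
    show ?R
    proof (intro allI impI ballI)
      fix f k
      assume f: "(\<Sum>k<m. act (f k) (v k)) = 0" and k: "k \<in> {..<m}"
      let ?c = "\<lambda>(k, j). coeff (f k mod r k) j"
      have "\<forall>k\<in>set ks. ?c k = 0"
        using L f reduce[of f] by metis
      then have "pol ?c k = 0"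
        using k unfolding pol_def by (intro sum.neutral) (auto simp: set_ks)
      then show "r k dvd f k"
        using k pol_mod[of k f] by (simp add: mod_eq_0_iff_dvd)
    qed
  next
    assume R: ?R
    show ?L
    proof (intro allI impI ballI)
      fix c k
      assume c: "(\<Sum>k\<in>set ks. scale (c k) (F k)) = 0" and "k \<in> set ks"
      then obtain i j where k: "k = (i, j)" "i < m" "j < degree (r i)"
        by (auto simp: set_ks)
      have "r i dvd pol c i"
        using R c k(2) by (auto simp: sum_eq)
      moreover have "degree (pol c i) < degree (r i)"
        using k(3) by (intro degree_lessI) (auto simp: coeff_pol)
      ultimately have "pol c i = 0"
        using dvd_imp_degree_le leD by blast
      then show "c k = 0"
        using coeff_pol[of c i j] k by simp
    qed
  qed
  ultimately show ?thesis
    unfolding kl ordered_basis_map_iff[OF \<open>distinct ks\<close>] cyclic_decomposition_def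
    using v by auto
qed

lemma represents_companions_iff:
  assumes "\<forall>r\<in>set rs. lead_coeff r = 1"
  shows "(\<exists>bs. represents scale u bs (diag_block_mat (map companion rs))) \<longleftrightarrow>
    (\<exists>v. cyclic_decomposition {..<length rs} v ((!) rs))"
proof -
  have *: "ordered_basis scale (krylov_list (length rs) v ((!) rs)) \<longleftrightarrow>
      cyclic_decomposition {..<length rs} v ((!) rs)" if "\<forall>k<length rs. act (rs ! k) (v k) = 0" for v
    using assms that by (intro ordered_basis_krylov_list_iff) auto
  have "cyclic_decomposition {..<length rs} v ((!) rs) \<Longrightarrow> \<forall>k<length rs. act (rs ! k) (v k) = 0" for v
    by (auto simp: cyclic_decomposition_def)
  with * show ?thesis
    unfolding represents_iff matrix_action_companions[OF assms] by blast
qed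

end

section \<open>The structure theorem\<close>

lemma add_self_char2:
  assumes "CHAR('c::comm_ring_1) = 2"
  shows "x + x = (0 :: 'c)"
proof -
  have "of_nat 2 = (0 :: 'c)"
    using of_nat_CHAR[where 'a = 'c] unfolding assms .
  then show ?thesis
    using mult_2[of x] by simp
qed

lemma neg_char2:
  assumes "CHAR('c::comm_ring_1) = 2"
  shows "- x = (x :: 'c)"
  by (rule minus_unique) (rule add_self_char2[OF assms])

lemma add_square_char2:
  assumes "CHAR('c::comm_ring_1) = 2"
  shows "(x + y)\<^sup>2 = x\<^sup>2 + (y :: 'c)\<^sup>2"
proof -
  have "(x + y)\<^sup>2 = x\<^sup>2 + y\<^sup>2 + (x * y + x * y)"
    by (simp add: power2_eq_square algebra_simps)
  then show ?thesis
    by (simp only: add_self_char2[OF assms] add_0_right)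
qed

lemma sum_lessThan_double:
  fixes F :: "nat \<Rightarrow> 'c::comm_monoid_add"
  shows "(\<Sum>k<2 * m. F k) = (\<Sum>i<m. F (2 * i) + F (Suc (2 * i)))"
  by (induction m) (auto simp: ac_simps)

context linear_endo
begin

lemma cyclic_decomposition_reindex:
  assumes h: "bij_betw h J I" and dec: "cyclic_decomposition I v r"
  shows "cyclic_decomposition J (\<lambda>j. v (h j)) (\<lambda>j. r (h j))"
  unfolding cyclic_decomposition_def
proof (intro conjI ballI allI impI)
  have sum_h: "(\<Sum>j\<in>J. act (f (h j)) (v (h j))) = (\<Sum>k\<in>I. act (f k) (v k))" for f
    by (rule sum.reindex_bij_betw[OF h])
  show "act (r (h j)) (v (h j)) = 0" if "j \<in> J" for j
    using dec bij_betwE[OF h] that by (auto simp: cyclic_decomposition_def)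
  show "\<exists>f. x = (\<Sum>j\<in>J. act (f j) (v (h j)))" for x
  proof -
    obtain f where "x = (\<Sum>k\<in>I. act (f k) (v k))"
      using dec unfolding cyclic_decomposition_def by blast
    then show ?thesis
      unfolding sum_h[symmetric] by (intro exI[of _ "\<lambda>j. f (h j)"])
  qed
  fix f j
  assume f: "(\<Sum>j\<in>J. act (f j) (v (h j))) = 0" and j: "j \<in> J"
  let ?f = "\<lambda>k. f (inv_into J h k)"
  have inv: "inv_into J h (h i) = i" if "i \<in> J" for i
    using bij_betw_inv_into_left[OF h that] .
  have "(\<Sum>k\<in>I. act (?f k) (v k)) = 0"
    unfolding sum_h[symmetric] using f by (simp add: inv)
  moreover have "\<forall>f. (\<Sum>k\<in>I. act (f k) (v k)) = 0 \<longrightarrow> (\<forall>k\<in>I. r k dvd f k)"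
    using dec by (simp add: cyclic_decomposition_def)
  ultimately have "\<forall>k\<in>I. r k dvd ?f k"
    by (elim allE[of _ ?f] mp)
  then have "r (h j) dvd ?f (h j)"
    using bij_betwE[OF h] j by blast
  then show "r (h j) dvd f j"
    by (simp add: inv j)
qed

text \<open>A factor 1 forces its generator to be 0, so indices with that factor can be added or
  dropped. This absorbs the arbitrary bound \<open>N\<close> in
  \<open>invariant_factors\<close>.\<close>

lemma cyclic_decomposition_pad:
  assumes dec: "cyclic_decomposition I v r" and fin: "finite I" "finite J"
    and one: "\<And>k. k \<in> (I - J) \<union> (J - I) \<Longrightarrow> r k = 1"
  shows "cyclic_decomposition J (\<lambda>k. if k \<in> I then v k else 0) r"
proof -
  let ?v = "\<lambda>k. if k \<in> I then v k else 0"
  have v0: "v k = 0" if "k \<in> I - J" for k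
    using dec one[of k] that by (auto simp: cyclic_decomposition_def dest: bspec[of _ _ k])
  have sums: "(\<Sum>k\<in>J. act (f k) (?v k)) = (\<Sum>k\<in>I. act (f k) (v k))" for f
    using fin by (intro sum.mono_neutral_cong) (auto simp: v0)
  show ?thesis
    unfolding cyclic_decomposition_def sums
  proof (intro conjI ballI allI impI)
    show "act (r k) (?v k) = 0" for k
      using dec by (auto simp: cyclic_decomposition_def)
    show "\<exists>f. x = (\<Sum>k\<in>I. act (f k) (v k))" for x
      using dec by (auto simp: cyclic_decomposition_def)
    fix f k
    assume "(\<Sum>k\<in>I. act (f k) (v k)) = 0" "k \<in> J"
    then show "r k dvd f k"
      using dec one[of k] by (cases "k \<in> I") (auto simp: cyclic_decomposition_def)
  qed
qed

lemma cyclic_decomposition_cong: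
  "(\<And>k. k \<in> I \<Longrightarrow> r k = s k) \<Longrightarrow> cyclic_decomposition I v r \<longleftrightarrow> cyclic_decomposition I v s"
  by (auto simp: cyclic_decomposition_def)

end

section \<open>Modules over the algebra generated by u and a\<close>

locale char2_endo = linear_endo scale u
  for scale :: "'a::field \<Rightarrow> 'b::ab_group_add \<Rightarrow> 'b" and u +
  fixes \<gamma> :: 'a and P :: "'a poly"
  assumes char2: "CHAR('a) = 2"
    and P: "P = [:- \<gamma>, 0, 1:]"
begin

lemma add_self_field [simp]: "x + x = (0 :: 'a)"
  by (rule add_self_char2[OF char2])

lemma two_eq_0_field [simp]: "2 = (0 :: 'a)"
  using add_self_field[of 1] unfolding one_add_one .

lemma add_self_poly [simp]: "f + f = (0 :: 'a poly)"
  by (intro poly_eqI) (simp only: coeff_add add_self_field coeff_0)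

lemma add_self_vector [simp]: "x + x = (0 :: 'b)"
  using scale_left_distrib[of 1 1 x] by simp

lemma neg_vector: "- x = (x :: 'b)"
  by (rule minus_unique) simp

lemma add_square_poly: "(f + g)\<^sup>2 = f\<^sup>2 + (g\<^sup>2 :: 'a poly)"
proof -
  have "(f + g)\<^sup>2 = f\<^sup>2 + g\<^sup>2 + (f * g + f * g)"
    by (simp add: power2_eq_square algebra_simps del: add_self_poly)
  then show ?thesis by simp
qed

lemma pderiv_P: "pderiv P = 0"
  by (simp add: P pderiv_pCons)

end

text \<open>Only one of the two square roots is kept, because b = a - u. The assumption
  \<open>norm_eq_0\<close> carries the information on p, q and their splitting fields.\<close>

locale twisted_endo = char2_endo scale u \<gamma> P
  for scale :: "'a::field \<Rightarrow> 'b::ab_group_add \<Rightarrow> 'b" and u \<gamma> P +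
  fixes a :: "'b \<Rightarrow> 'b" and \<alpha> :: 'a
  assumes linear_a: "Vector_Spaces.linear scale scale a"
    and a_square: "a (a x) = scale \<alpha> x"
    and a_u: "a (u x) + u (a x) = act P x"
    and norm_eq_0: "c0\<^sup>2 + \<gamma> * c1\<^sup>2 + \<alpha> * (c2\<^sup>2 + \<gamma> * c3\<^sup>2) = 0 \<Longrightarrow>
      c0 = 0 \<and> c1 = 0 \<and> c2 = 0 \<and> c3 = 0"
begin

sublocale a: Vector_Spaces.linear scale scale a
  by (fact linear_a)

text \<open>The commutator with \<open>a\<close> is a derivation. It sends \<open>u\<close> to P(u),
  which commutes with \<open>u\<close>, and therefore f(u) to (f' P)(u).\<close>

lemma a_act: "a (act f x) = act f (a x) + act (pderiv f * P) x"
proof (induction f)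
  case 0
  then show ?case by (simp add: a.zero)
next
  case (pCons c f)
  have "a (u (act f x)) = act P (act f x) - u (a (act f x))"
    using a_u[of "act f x"] by (simp add: eq_diff_eq)
  also have "\<dots> = act P (act f x) + u (a (act f x))"
    by (simp only: diff_conv_add_uminus neg_vector)
  also have "\<dots> = act f (act P x) + (u (act f (a x)) + u (act (pderiv f * P) x))"
    by (simp only: pCons.IH endo.add act_commute[of P f])
  finally have "a (act (pCons c f) x) =
      scale c (a x) + (act f (act P x) + (u (act f (a x)) + u (act (pderiv f * P) x)))"
    by (simp only: act_pCons a.add a.scale)
  also have "\<dots> = act (pCons c f) (a x) + act (f * P + pCons 0 (pderiv f * P)) x"
    by (simp add: act_pCons act_add act_mult[of f P] add_ac)
  also have "f * P + pCons 0 (pderiv f * P) = pderiv (pCons c f) * P"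
    by (simp add: pderiv_pCons distrib_right)
  finally show ?case .
qed

lemma a_act_P: "a (act P x) = act P (a x)"
  by (simp add: a_act pderiv_P)

text \<open>Modulo P the square of every polynomial is a constant: f reduces to c0 + c1 t, squaring
  is additive, and t^2 reduces to \<gamma>. So c is a value of the form in \<open>norm_eq_0\<close>,
  and it vanishes only if both remainders do.\<close>

lemma P_dvd_norm:
  "\<exists>c. P dvd g\<^sup>2 + Polynomial.smult \<alpha> (h\<^sup>2) - [:c:] \<and> (c = 0 \<longrightarrow> P dvd g \<and> P dvd h)"
proof -
  have deg: "degree P = 2" "P \<noteq> 0"
    by (auto simp: P)
  have square: "\<exists>c0 c1. P dvd f\<^sup>2 - [:c0\<^sup>2 + \<gamma> * c1\<^sup>2:] \<and> (c0 = 0 \<and> c1 = 0 \<longrightarrow> P dvd f)" for f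
  proof -
    define c0 c1 where "c0 = coeff (f mod P) 0" and "c1 = coeff (f mod P) 1"
    have "degree (f mod P) < 2"
      using degree_mod_less[of P f] deg by auto
    then have "f mod P = [:c0, c1:]"
      by (intro poly_eqI)
        (auto simp: c0_def c1_def coeff_pCons coeff_eq_0 split: nat.split)
    then have f: "f = P * (f div P) + [:c0, c1:]"
      by (metis mult_div_mod_eq)
    have "f\<^sup>2 = (P * (f div P))\<^sup>2 + [:c0, c1:]\<^sup>2"
      by (subst f) (rule add_square_poly)
    also have "[:c0, c1:]\<^sup>2 = [:c0\<^sup>2 + \<gamma> * c1\<^sup>2:] + P * [:c1\<^sup>2:]"
      by (simp add: P power2_eq_square algebra_simps)
    finally have "f\<^sup>2 - [:c0\<^sup>2 + \<gamma> * c1\<^sup>2:] = P * (P * (f div P)\<^sup>2 + [:c1\<^sup>2:])"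
      by (simp add: power2_eq_square algebra_simps)
    moreover have "P dvd f" if "c0 = 0 \<and> c1 = 0"
      using f that by (metis add.right_neutral dvd_triv_left pCons_0_0)
    ultimately show ?thesis
      by (intro exI[of _ c0] exI[of _ c1]) auto
  qed
  obtain c0 c1 where g: "P dvd g\<^sup>2 - [:c0\<^sup>2 + \<gamma> * c1\<^sup>2:]" "c0 = 0 \<and> c1 = 0 \<longrightarrow> P dvd g"
    using square by blast
  obtain c2 c3 where h: "P dvd h\<^sup>2 - [:c2\<^sup>2 + \<gamma> * c3\<^sup>2:]" "c2 = 0 \<and> c3 = 0 \<longrightarrow> P dvd h"
    using square by blast
  let ?c = "c0\<^sup>2 + \<gamma> * c1\<^sup>2 + \<alpha> * (c2\<^sup>2 + \<gamma> * c3\<^sup>2)"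
  have "P dvd (g\<^sup>2 - [:c0\<^sup>2 + \<gamma> * c1\<^sup>2:]) + Polynomial.smult \<alpha> (h\<^sup>2 - [:c2\<^sup>2 + \<gamma> * c3\<^sup>2:])"
    by (intro dvd_add dvd_smult g h)
  also have "\<dots> = g\<^sup>2 + Polynomial.smult \<alpha> (h\<^sup>2) - [:?c:]"
    by (simp add: smult_diff_right)
  finally show ?thesis
    using norm_eq_0[of c0 c1 c2 c3] g(2) h(2) by (intro exI[of _ ?c]) auto
qed

text \<open>Since \<open>a\<close> can be moved past polynomials in \<open>u\<close> and squares to
  a scalar, every element of the algebra generated by \<open>u\<close> and \<open>a\<close> can be
  written g(u) + h(u) a. The values of \<open>comb\<close> thus form the submodule generated by the
  \<open>x i\<close> over that algebra.\<close>

definition comb :: "nat \<Rightarrow> (nat \<Rightarrow> 'b) \<Rightarrow> (nat \<Rightarrow> 'a poly) \<Rightarrow> (nat \<Rightarrow> 'a poly) \<Rightarrow> 'b" where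
  "comb m x g h = (\<Sum>i<m. act (g i) (x i) + act (h i) (a (x i)))"

definition generated :: "nat \<Rightarrow> (nat \<Rightarrow> 'b) \<Rightarrow> 'b set" where
  "generated m x = {comb m x g h | g h. True}"

text \<open>Over F[u] this is a direct sum in which \<open>x i\<close> and \<open>a (x i)\<close>
  have the same annihilator P^(n i); that \<open>a (x i)\<close> is killed follows from
  \<open>a_act_P\<close>. Positive exponents exclude zero members, so that the size of a family is
  bounded.\<close>

definition free_family :: "nat \<Rightarrow> (nat \<Rightarrow> 'b) \<Rightarrow> (nat \<Rightarrow> nat) \<Rightarrow> bool" where
  "free_family m x n \<longleftrightarrow> (\<forall>i<m. n i > 0 \<and> act (P ^ n i) (x i) = 0) \<and>
     (\<forall>g h. comb m x g h = 0 \<longrightarrow> (\<forall>i<m. P ^ n i dvd g i \<and> P ^ n i dvd h i))"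

lemma comb_add: "comb m x g h + comb m x g' h' = comb m x (\<lambda>i. g i + g' i) (\<lambda>i. h i + h' i)"
  by (simp add: comb_def act_add sum.distrib[symmetric] add_ac)

lemma act_comb: "act f (comb m x g h) = comb m x (\<lambda>i. f * g i) (\<lambda>i. f * h i)"
  by (simp add: comb_def act_sum_right act_add_right act_mult)

lemma a_comb: "a (comb m x g h) =
  comb m x (\<lambda>i. pderiv (g i) * P + Polynomial.smult \<alpha> (h i)) (\<lambda>i. g i + pderiv (h i) * P)"
  by (simp add: comb_def a.sum a.add a_act a_square act_add act_smult act_scale_right add_ac)

lemma generatedI: "y = comb m x g h \<Longrightarrow> y \<in> generated m x"
  unfolding generated_def by blast

lemma generated_act: "y \<in> generated m x \<Longrightarrow> act f y \<in> generated m x"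
  unfolding generated_def using act_comb by blast

lemma generated_a: "y \<in> generated m x \<Longrightarrow> a y \<in> generated m x"
  unfolding generated_def using a_comb by blast

lemma subspace_generated: "subspace (generated m x)"
proof (rule subspaceI)
  have "comb m x (\<lambda>_. 0) (\<lambda>_. 0) = 0"
    by (simp add: comb_def)
  then show "0 \<in> generated m x"
    by (rule generatedI[OF sym])
  show "y + z \<in> generated m x" if "y \<in> generated m x" "z \<in> generated m x" for y z
    using that comb_add unfolding generated_def by blast
  show "scale c y \<in> generated m x" if "y \<in> generated m x" for c y
    using generated_act[OF that, of "[:c:]"] by (simp add: act_const)
qed

lemma generated_base:
  assumes "i < m"
  shows "x i \<in> generated m x"
proof -
  have "comb m x (\<lambda>j. if j = i then 1 else 0) (\<lambda>_. 0) = (\<Sum>j<m. if j = i then x j else 0)"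
    unfolding comb_def by (intro sum.cong) auto
  also have "\<dots> = x i"
    using assms by simp
  finally show ?thesis
    by (rule generatedI[OF sym])
qed

lemma comb_in_generated:
  assumes "\<And>i. i < m \<Longrightarrow> x i \<in> generated k y"
  shows "comb m x g h \<in> generated k y"
  unfolding comb_def using assms
  by (intro subspace_sum[OF subspace_generated] subspace_add[OF subspace_generated]
      generated_act generated_a) auto

text \<open>
  On the kernel of \<open>act P\<close> the operators \<open>u\<close> and \<open>a\<close> commute, and \<open>g(u) + h(u) a\<close> squares to a
  scalar there, which is nonzero by \<open>norm_eq_0\<close> unless the operator vanishes on that kernel.
\<close>

lemma generated_kernel_dvd:
  assumes z: "act P z = 0" "z \<notin> generated m x"
    and gh: "act g z + act h (a z) \<in> generated m x"
  shows "P dvd g \<and> P dvd h"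
proof -
  obtain c where c: "P dvd g\<^sup>2 + Polynomial.smult \<alpha> (h\<^sup>2) - [:c:]"
    and c0: "c = 0 \<longrightarrow> P dvd g \<and> P dvd h"
    using P_dvd_norm by blast
  have az: "act P (a z) = 0"
    by (simp add: a_act_P[symmetric] z a.zero)
  let ?y = "act g z + act h (a z)"
  \<comment> \<open>The derivative terms from \<open>a_act\<close> contain the factor P(u), which
    kills both z and a z.\<close>
  have ay: "a ?y = act g (a z) + scale \<alpha> (act h z)"
    by (simp add: a.add a_act act_mult z az a_square act_scale_right)
  have cross: "act g (act h (a z)) + act h (act g (a z)) = 0"
    by (simp add: act_commute[of g h])
  \<comment> \<open>Applying the same operator to ?y stays inside the submodule and gives c z, so a
    nonzero c would put z itself there.\<close>
  have "act g ?y + act h (a ?y) = act (g\<^sup>2 + Polynomial.smult \<alpha> (h\<^sup>2)) z +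
      (act g (act h (a z)) + act h (act g (a z)))"
    unfolding ay by (simp only: act_add_right act_add act_smult power2_eq_square act_mult
        act_scale_right add_ac)
  also have "\<dots> = act (g\<^sup>2 + Polynomial.smult \<alpha> (h\<^sup>2)) z"
    unfolding cross by simp
  also have "\<dots> = scale c z"
    using act_dvd_eq_0[OF c z(1)] by (simp add: act_diff act_const)
  finally have "scale c z \<in> generated m x"
    using gh by (metis generated_act generated_a subspace_add subspace_generated)
  then have "scale (inverse c) (scale c z) \<in> generated m x"
    by (rule subspace_scale[OF subspace_generated])
  then have "c = 0"
    using z(2) by (cases "c = 0") (simp_all add: scale_scale)
  then show ?thesis
    using c0 by simp
qed

text \<open>In a relation, the term belonging to z lies in the old submodule. By
  \<open>generated_kernel_dvd\<close> its coefficients are multiples of P, so this term is zero and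
  a relation among the old members remains.\<close>

lemma free_family_extend:
  assumes free: "free_family m x n" and z: "act P z = 0" "z \<notin> generated m x"
  shows "free_family (Suc m) (x(m := z)) (n(m := 1))"
  unfolding free_family_def
proof (intro conjI allI impI)
  fix i
  assume "i < Suc m"
  then show "(n(m := 1)) i > 0" "act (P ^ (n(m := 1)) i) ((x(m := z)) i) = 0"
    using free z(1) by (auto simp: free_family_def less_Suc_eq)
next
  fix g h i
  assume i: "i < Suc m" and c0: "comb (Suc m) (x(m := z)) g h = 0"
  let ?y = "act (g m) z + act (h m) (a z)"
  have split: "comb (Suc m) (x(m := z)) g h = comb m x g h + ?y"
    by (simp add: comb_def)
  have gen: "comb m x g h \<in> generated m x"
    by (auto simp: generated_def)
  have "?y = - comb m x g h"
    using c0 unfolding split by (simp add: eq_neg_iff_add_eq_0 add.commute)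
  then have "?y \<in> generated m x"
    using subspace_neg[OF subspace_generated gen] by simp
  then have dvd: "P dvd g m" "P dvd h m"
    using generated_kernel_dvd[OF z] by auto
  have "act P (a z) = 0"
    by (simp add: a_act_P[symmetric] z a.zero)
  then have "?y = 0"
    using act_dvd_eq_0[OF dvd(1) z(1)] act_dvd_eq_0[OF dvd(2)] by simp
  then have "comb m x g h = 0"
    using c0 split by simp
  then show "P ^ (n(m := 1)) i dvd g i" "P ^ (n(m := 1)) i dvd h i"
    using free dvd i by (auto simp: free_family_def less_Suc_eq)
qed

text \<open>Guarantees a largest family in \<open>free_family_exists\<close>. Constant coefficients
  suffice: P has degree 2 and divides no nonzero constant, so the members are linearly independent
  over the base field.\<close>

lemma free_family_le_card:
  assumes free: "free_family m x n" and B: "finite B" "span B = UNIV"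
  shows "m \<le> card B"
proof -
  have deg: "degree P = 2" "P \<noteq> 0"
    by (auto simp: P)
  have ind: "c i = 0" if c: "(\<Sum>i<m. scale (c i) (x i)) = 0" and i: "i < m" for c i
  proof -
    have "comb m x (\<lambda>i. [:c i:]) (\<lambda>_. 0) = 0"
      using c by (simp add: comb_def act_const)
    then have "P ^ n i dvd [:c i:]" "n i > 0"
      using free i by (auto simp: free_family_def)
    then have "P dvd [:c i:]"
      using dvd_power_le[of P P 1 "n i"] dvd_trans by (metis Suc_leI One_nat_def dvd_refl power_one_right)
    then show "c i = 0"
      using dvd_imp_degree_le[of P "[:c i:]"] deg by auto
  qed
  show ?thesis
    by (rule independent_family_le_card[OF _ B]) (rule ind)
qed

text \<open>Induction on the nilpotency exponent, for all stable subspaces at once because the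
  hypothesis is applied to the image P(u) W. Generators of the image are lifted through P(u), which
  raises each exponent by one, and the lifted family is completed by vectors from the kernel of
  P(u).\<close>

theorem free_family_exists:
  assumes B: "finite B" "span B = UNIV"
    and W: "subspace W" "\<And>x. x \<in> W \<Longrightarrow> u x \<in> W" "\<And>x. x \<in> W \<Longrightarrow> a x \<in> W"
    and nil: "\<And>x. x \<in> W \<Longrightarrow> act (P ^ N) x = 0"
  shows "\<exists>m x n. free_family m x n \<and> (\<forall>i<m. x i \<in> W) \<and> W \<subseteq> generated m x"
  using W nil
proof (induction N arbitrary: W)
  case 0
  then have "x = 0" if "x \<in> W" for x
    using that by simp
  then have "W \<subseteq> generated 0 (\<lambda>_. 0)"
    using subspace_0[OF subspace_generated] by auto
  moreover have "free_family 0 (\<lambda>_. 0) (\<lambda>_. 0)"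
    by (simp add: free_family_def)
  ultimately show ?case by blast
next
  case (Suc N)
  let ?W = "act P ` W"
  have "subspace ?W"
    using act_linear[THEN Vector_Spaces.linear.axioms(3)] Suc.prems(1)
    by (rule module_hom.subspace_image)
  moreover have "u y \<in> ?W" "a y \<in> ?W" "act (P ^ N) y = 0" if y: "y \<in> ?W" for y
  proof -
    obtain x where x: "x \<in> W" "y = act P x"
      using y by blast
    have "u y = act P (u x)"
      using act_commute[of "[:0, 1:]" P x] x(2) by simp
    then show "u y \<in> ?W"
      using Suc.prems(2) x(1) by blast
    show "a y \<in> ?W"
      using Suc.prems(3) x by (auto simp: a_act_P)
    show "act (P ^ N) y = 0"
      using Suc.prems(4)[OF x(1)] x(2) by (simp add: act_mult[symmetric] mult.commute)
  qed
  ultimately obtain m x n where free: "free_family m x n" and xW: "\<forall>i<m. x i \<in> ?W"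
    and gen: "?W \<subseteq> generated m x"
    using Suc.IH[of ?W] by blast
  have "\<forall>i. \<exists>y. i < m \<longrightarrow> y \<in> W \<and> x i = act P y"
    using xW by blast
  then obtain v where v: "\<And>i. i < m \<Longrightarrow> v i \<in> W" "\<And>i. i < m \<Longrightarrow> x i = act P (v i)"
    by metis
  have comb_v: "act P (comb m v g h) = comb m x g h" for g h
    by (simp add: comb_def act_sum_right act_add_right v(2) a_act_P act_commute[of P])
  have free_v: "free_family m v (\<lambda>i. Suc (n i))"
    unfolding free_family_def
  proof (intro conjI allI impI)
    fix i
    assume "i < m"
    then show "act (P ^ Suc (n i)) (v i) = 0"
      using free v(2) by (auto simp: free_family_def act_mult power_Suc2 simp del: power_Suc)
  next
    fix g h i
    assume i: "i < m" and c0: "comb m v g h = 0"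
    have "comb m x g h = 0"
      using c0 comb_v[of g h] by simp
    then have dvd: "P ^ n j dvd g j" "P ^ n j dvd h j" "n j > 0" if "j < m" for j
      using free that by (auto simp: free_family_def)
    \<comment> \<open>As the exponents are positive, one factor P can be pulled out of all
      coefficients. It turns each \<open>v j\<close> into \<open>x j\<close>, and freeness of the
      \<open>x j\<close> supplies the remaining power.\<close>
    have "P dvd g j" "P dvd h j" if "j < m" for j
      using dvd[OF that] by (metis dvd_power dvd_trans)+
    then obtain g' h' where gh: "\<And>j. j < m \<Longrightarrow> g j = P * g' j" "\<And>j. j < m \<Longrightarrow> h j = P * h' j"
      unfolding dvd_def by metis
    have "comb m x g' h' = act P (comb m v g' h')"
      by (simp add: comb_v)
    also have "\<dots> = comb m v g h"
      by (simp add: act_comb) (simp add: comb_def gh)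
    finally have "comb m x g' h' = 0"
      using c0 by simp
    then have "P ^ n i dvd g' i" "P ^ n i dvd h' i"
      using free i by (auto simp: free_family_def)
    then show "P ^ Suc (n i) dvd g i" "P ^ Suc (n i) dvd h i"
      by (simp_all add: gh i mult_dvd_mono)
  qed simp
  \<comment> \<open>Sizes of the free families in W that prolong \<open>v\<close>. A largest one
    must already generate W.\<close>
  define S where "S = {k. \<exists>y l. free_family k y l \<and> (\<forall>i<k. y i \<in> W) \<and> m \<le> k \<and> (\<forall>i<m. y i = v i)}"
  have "m \<in> S"
    unfolding S_def using free_v v(1) by blast
  moreover have "S \<subseteq> {..card B}"
    unfolding S_def using free_family_le_card[OF _ B] by blast
  then have "finite S"
    by (rule finite_subset) simp
  ultimately have "Max S \<in> S" and max: "\<And>k. k \<in> S \<Longrightarrow> k \<le> Max S"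
    by (auto intro: Max_in)
  then obtain k y l where k: "k = Max S" and free_y: "free_family k y l"
    and yW: "\<forall>i<k. y i \<in> W" and mk: "m \<le> k" and yv: "\<forall>i<m. y i = v i"
    unfolding S_def by blast
  have "w \<in> generated k y" if w: "w \<in> W" for w
  proof -
    obtain g h where gh: "act P w = comb m x g h"
      using gen w by (auto simp: generated_def)
    have v_gen: "v i \<in> generated k y" if "i < m" for i
      using generated_base[of i k y] that mk yv by simp
    have cv: "comb m v g h \<in> generated k y"
      by (rule comb_in_generated) (rule v_gen)
    \<comment> \<open>P(u) w is a combination of the x i = P(u) (v i). Subtracting the same
      combination of the \<open>v i\<close> leaves an element of the kernel of P(u).\<close>
    let ?z = "w - comb m v g h"
    have "act P ?z = 0"
      by (simp add: act_diff_right comb_v gh)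
    have "comb m v g h \<in> W"
      unfolding comb_def using v(1) Suc.prems(3)
      by (intro subspace_sum[OF Suc.prems(1)] subspace_add[OF Suc.prems(1)]
          subspace_act[OF Suc.prems(1,2)]) auto
    then have "?z \<in> W"
      using subspace_diff[OF Suc.prems(1) w] by blast
    have "?z \<in> generated k y"
    proof (rule ccontr)
      assume "?z \<notin> generated k y"
      then have "free_family (Suc k) (y(k := ?z)) (l(k := 1))"
        using free_family_extend[OF free_y \<open>act P ?z = 0\<close>] by blast
      moreover have "\<forall>i<Suc k. (y(k := ?z)) i \<in> W"
        using yW \<open>?z \<in> W\<close> by (auto simp: less_Suc_eq)
      moreover have "\<forall>i<m. (y(k := ?z)) i = v i"
        using yv mk by auto
      ultimately have "Suc k \<in> S"
        unfolding S_def using mk le_SucI by blast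
      then show False
        using max k by fastforce
    qed
    then have "?z + comb m v g h \<in> generated k y"
      using subspace_add[OF subspace_generated] cv by blast
    then show ?thesis by simp
  qed
  then show ?case
    using free_y yW by blast
qed

text \<open>Over F[u] each member x i contributes the two summands generated by x i and a (x i).
  They are placed at positions 2i and 2i + 1, which is the origin of \<open>k div 2\<close>.\<close>

corollary paired_decomposition_exists:
  assumes B: "finite B" "span B = UNIV" and nil: "\<And>x. act (P ^ N) x = 0"
  shows "\<exists>(m::nat) n v. (\<forall>i<m. n i > 0) \<and> cyclic_decomposition {..<2 * m} v (\<lambda>k. P ^ n (k div 2))"
proof -
  obtain m x n where free: "free_family m x n" and gen: "UNIV \<subseteq> generated m x"
    using free_family_exists[OF B, of UNIV N] nil by auto
  define v where "v k = (if even k then x (k div 2) else a (x (k div 2)))" for k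
  have comb: "(\<Sum>k<2 * m. act (f k) (v k)) = comb m x (\<lambda>i. f (2 * i)) (\<lambda>i. f (Suc (2 * i)))" for f
    by (simp add: sum_lessThan_double v_def comb_def)
  have a0: "act (P ^ i) (a y) = a (act (P ^ i) y)" for i y
    by (induction i arbitrary: y) (auto simp: act_mult a_act_P)
  have dec: "cyclic_decomposition {..<2 * m} v (\<lambda>k. P ^ n (k div 2))"
    unfolding cyclic_decomposition_def comb
  proof (intro conjI ballI allI impI)
    fix k
    assume "k \<in> {..<2 * m}"
    then show "act (P ^ n (k div 2)) (v k) = 0"
      using free by (auto simp: free_family_def v_def a0 a.zero)
  next
    fix y
    have "y \<in> generated m x"
      using gen by blast
    then obtain g h where y: "y = comb m x g h"
      unfolding generated_def by blast
    show "\<exists>f. y = comb m x (\<lambda>i. f (2 * i)) (\<lambda>i. f (Suc (2 * i)))"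
      unfolding y by (intro exI[of _ "\<lambda>k. if even k then g (k div 2) else h (k div 2)"]) simp
  next
    fix f k
    assume "comb m x (\<lambda>i. f (2 * i)) (\<lambda>i. f (Suc (2 * i))) = 0" and k: "k \<in> {..<2 * m}"
    then have dvd: "P ^ n i dvd f (2 * i)" "P ^ n i dvd f (Suc (2 * i))" if "i < m" for i
      using free that by (auto simp: free_family_def)
    have "k div 2 < m"
      using k by auto
    then show "P ^ n (k div 2) dvd f k"
      using dvd[of "k div 2"] by (cases "even k") auto
  qed
  have pos: "\<forall>i<m. n i > 0"
    using free by (auto simp: free_family_def)
  show ?thesis
    by (intro exI conjI, rule pos, rule dec)
qed

end

section \<open>Paired decompositions\<close>

lemma diag_block_mat_concat: "diag_block_mat (map diag_block_mat Ass) = diag_block_mat (concat Ass)"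
  by (induction Ass) (simp_all add: diag_block_mat_append Let_def)

lemma length_concat_pairs: "length (concat (map (\<lambda>x. [f x, f x]) xs)) = 2 * length xs"
  by (induction xs) auto

lemma nth_concat_pairs:
  "k < 2 * length xs \<Longrightarrow> concat (map (\<lambda>x. [f x, f x]) xs) ! k = f (xs ! (k div 2))"
proof (induction xs arbitrary: k)
  case (Cons x xs)
  consider "k = 0" | "k = 1" | j where "k = Suc (Suc j)"
    by (metis One_nat_def not0_implies_Suc)
  then show ?case
    using Cons by cases auto
qed simp

text \<open>Moves adjacent positions 2i, 2i + 1 together, so that sorting the exponents tears no
  pair apart.\<close>

lemma bij_betw_double:
  assumes "bij_betw \<sigma> {..<m} {..<(m::nat)}"
  shows "bij_betw (\<lambda>k. 2 * \<sigma> (k div 2) + k mod 2) {..<2 * m} {..<2 * m}"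
proof -
  let ?h = "\<lambda>k. 2 * \<sigma> (k div 2) + k mod 2"
  have inj: "inj_on ?h {..<2 * m}"
  proof (rule inj_onI)
    fix k l
    assume kl: "k \<in> {..<2 * m}" "l \<in> {..<2 * m}" and eq: "?h k = ?h l"
    have "?h k div 2 = ?h l div 2" "?h k mod 2 = ?h l mod 2"
      by (simp_all only: eq)
    then have "\<sigma> (k div 2) = \<sigma> (l div 2)" "k mod 2 = l mod 2"
      by simp_all
    moreover have "k div 2 \<in> {..<m}" "l div 2 \<in> {..<m}"
      using kl by auto
    ultimately have "k div 2 = l div 2"
      using bij_betw_imp_inj_on[OF assms] by (auto dest: inj_onD)
    then show "k = l"
      using \<open>k mod 2 = l mod 2\<close> by (metis div_mult_mod_eq)
  qed
  have "?h k < 2 * m" if "k < 2 * m" for k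
  proof -
    have "\<sigma> (k div 2) < m"
      using bij_betwE[OF assms] that by auto
    then show ?thesis
      by linarith
  qed
  then have "?h ` {..<2 * m} = {..<2 * m}"
    by (intro endo_inj_surj inj) auto
  with inj show ?thesis
    by (simp add: bij_betw_def)
qed

lemma exists_antimono_sorting:
  fixes n :: "nat \<Rightarrow> nat"
  shows "\<exists>\<sigma>. bij_betw \<sigma> {..<m} {..<m} \<and> (\<forall>i j. i \<le> j \<longrightarrow> j < m \<longrightarrow> n (\<sigma> j) \<le> n (\<sigma> i))"
proof -
  define xs where "xs = rev (sort_key n [0..<m])"
  have xs: "distinct xs" "length xs = m" "set xs = {..<m}"
    by (auto simp: xs_def)
  have sorted: "sorted (rev (map n xs))"
    by (simp add: xs_def rev_map)
  have "n (xs ! j) \<le> n (xs ! i)" if "i \<le> j" "j < m" for i j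
    using sorted_rev_nth_mono[OF sorted that(1)] that xs(2) by simp
  moreover have "bij_betw ((!) xs) {..<m} {..<m}"
    by (rule bij_betw_nth[OF xs(1)]) (simp_all add: xs)
  ultimately show ?thesis by blast
qed

context char2_endo
begin

lemma lead_coeff_P_power: "lead_coeff (P ^ n) = 1"
  by (simp add: lead_coeff_power P)

lemma P_power_dvd_1: "P ^ n dvd 1 \<Longrightarrow> P ^ n = 1"
proof -
  assume "P ^ n dvd 1"
  then have "degree (P ^ n) = 0"
    using dvd_imp_degree_le[of "P ^ n" 1] by simp
  moreover have "degree (P ^ n) = n * 2"
    using degree_power_eq[of P n] by (simp add: P)
  ultimately show "P ^ n = 1" by simp
qed

text \<open>The common normal form: each of the three conditions of the theorem is shown to be
  equivalent to the existence of such data.\<close>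

definition paired :: "nat \<Rightarrow> (nat \<Rightarrow> nat) \<Rightarrow> (nat \<Rightarrow> 'b) \<Rightarrow> bool" where
  "paired m n v \<longleftrightarrow> (\<forall>i<m. n i > 0) \<and> cyclic_decomposition {..<2 * m} v (\<lambda>k. P ^ n (k div 2))"

lemma paired_iff_represents:
  "(\<exists>m n v. paired m n v) \<longleftrightarrow>
    (\<exists>ns bs. (\<forall>n\<in>set ns. n > 0) \<and>
      represents scale u bs
        (diag_block_mat (map (\<lambda>n. diag_block_mat [companion (P ^ n), companion (P ^ n)]) ns)))"
    (is "_ \<longleftrightarrow> (\<exists>ns bs. _ \<and> represents scale u bs (?M ns))")
proof -
  let ?rs = "\<lambda>ns. concat (map (\<lambda>n. [P ^ n, P ^ n]) ns)"
  have M: "?M ns = diag_block_mat (map companion (?rs ns))" for ns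
    using diag_block_mat_concat[of "map (\<lambda>n. [companion (P ^ n), companion (P ^ n)]) ns"]
    by (simp add: map_concat comp_def)
  have rs: "\<forall>r\<in>set (?rs ns). lead_coeff r = 1" for ns
    by (auto simp: lead_coeff_P_power)
  have rep: "(\<exists>bs. represents scale u bs (?M ns)) \<longleftrightarrow>
      (\<exists>v. cyclic_decomposition {..<2 * length ns} v (\<lambda>k. P ^ (ns ! (k div 2))))" for ns
    unfolding M represents_companions_iff[OF rs] length_concat_pairs
    by (intro ex_cong1 cyclic_decomposition_cong) (simp add: nth_concat_pairs)
  show ?thesis
  proof
    assume "\<exists>m n v. paired m n v"
    then obtain m :: nat and n v where pos: "\<forall>i<m. n i > 0"
      and dec: "cyclic_decomposition {..<2 * m} v (\<lambda>k. P ^ n (k div 2))"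
      unfolding paired_def by blast
    let ?ns = "map n [0..<m]"
    have "cyclic_decomposition {..<2 * length ?ns} v (\<lambda>k. P ^ (?ns ! (k div 2)))"
      using dec by (subst cyclic_decomposition_cong[where s = "\<lambda>k. P ^ n (k div 2)"]) auto
    then have "\<exists>bs. represents scale u bs (?M ?ns)"
      unfolding rep by blast
    moreover have "\<forall>n\<in>set ?ns. n > 0"
      using pos by auto
    ultimately show "\<exists>ns bs. (\<forall>n\<in>set ns. n > 0) \<and> represents scale u bs (?M ns)"
      by blast
  next
    assume "\<exists>ns bs. (\<forall>n\<in>set ns. n > 0) \<and> represents scale u bs (?M ns)"
    then obtain ns v where "\<forall>n\<in>set ns. n > 0"
      "cyclic_decomposition {..<2 * length ns} v (\<lambda>k. P ^ (ns ! (k div 2)))"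
      using rep by blast
    then have "paired (length ns) ((!) ns) v"
      by (simp add: paired_def)
    then show "\<exists>m n v. paired m n v" by blast
  qed
qed

text \<open>Sorting the pairs by decreasing exponent turns the list of powers into a divisibility
  chain. In the other direction a chain of powers of P whose members agree in pairs only has to be
  cut off before its constant tail.\<close>

lemma paired_iff_invariant_factors:
  "(\<exists>m n v. paired m n v) \<longleftrightarrow>
    (\<exists>r. invariant_factors scale u r \<and> (\<forall>k\<ge>1. \<exists>n. r k = P ^ n) \<and>
      (\<forall>k\<ge>1. r (2 * k - 1) = r (2 * k)))"
proof
  assume "\<exists>m n v. paired m n v"
  then obtain m :: nat and n v where dec: "cyclic_decomposition {..<2 * m} v (\<lambda>k. P ^ n (k div 2))"
    unfolding paired_def by blast
  obtain \<sigma> where bij: "bij_betw \<sigma> {..<m} {..<m}"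
    and anti: "\<And>i j. i \<le> j \<Longrightarrow> j < m \<Longrightarrow> n (\<sigma> j) \<le> n (\<sigma> i)"
    using exists_antimono_sorting[of m n] by blast
  \<comment> \<open>Invariant factors are counted from 1, so positions 2i + 1 and 2i + 2 receive the
    exponent of pair \<open>\<sigma> i\<close>.\<close>
  define r where "r k = (if k \<le> 2 * m then P ^ n (\<sigma> ((k - 1) div 2)) else 1)" for k
  have power: "\<exists>e. r k = P ^ e" for k
    unfolding r_def by (metis power_0)
  have "r (i + 1) dvd r i" if "i \<ge> 1" for i
  proof (cases "i + 1 \<le> 2 * m")
    case True
    then have "n (\<sigma> (i div 2)) \<le> n (\<sigma> ((i - 1) div 2))"
      by (intro anti div_le_mono) auto
    then show ?thesis
      using True by (simp add: r_def le_imp_power_dvd)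
  qed (simp add: r_def)
  moreover have monic_r: "lead_coeff (r i) = 1" for i
    using power[of i] lead_coeff_P_power by auto
  moreover have "\<exists>bs. represents scale u bs (diag_block_mat (map (\<lambda>i. companion (r i)) [1..<Suc (2 * m)]))"
  proof -
    define rs where "rs = map r [1..<Suc (2 * m)]"
    have monic: "\<forall>r\<in>set rs. lead_coeff r = 1"
      by (auto simp: rs_def monic_r)
    let ?h = "\<lambda>k. 2 * \<sigma> (k div 2) + k mod 2"
    have len: "length rs = 2 * m"
      by (simp add: rs_def)
    have eq: "rs ! k = P ^ n (?h k div 2)" if "k < 2 * m" for k
      using that by (simp add: rs_def r_def del: upt_Suc)
    have "cyclic_decomposition {..<2 * m} (\<lambda>k. v (?h k)) (\<lambda>k. P ^ n (?h k div 2))"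
      by (rule cyclic_decomposition_reindex[OF bij_betw_double[OF bij] dec])
    then have "cyclic_decomposition {..<length rs} (\<lambda>k. v (?h k)) ((!) rs)"
      unfolding len
      by (subst cyclic_decomposition_cong[where s = "\<lambda>k. P ^ n (?h k div 2)"]) (simp_all add: eq)
    then have "\<exists>bs. represents scale u bs (diag_block_mat (map companion rs))"
      unfolding represents_companions_iff[OF monic] by blast
    then show ?thesis
      by (simp add: rs_def comp_def)
  qed
  moreover have "\<forall>i>2 * m. r i = 1"
    by (simp add: r_def)
  ultimately have "invariant_factors scale u r"
    unfolding invariant_factors_def by blast
  moreover have "r (2 * k - 1) = r (2 * k)" if k: "k \<ge> 1" for k
  proof -
    have "2 * k - 1 \<le> 2 * m \<longleftrightarrow> 2 * k \<le> 2 * m"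
      using k by presburger
    moreover have "(2 * k - 1 - 1) div 2 = (2 * k - 1) div 2"
      using k by presburger
    ultimately show ?thesis
      unfolding r_def by simp
  qed
  ultimately show "\<exists>r. invariant_factors scale u r \<and> (\<forall>k\<ge>1. \<exists>n. r k = P ^ n) \<and>
      (\<forall>k\<ge>1. r (2 * k - 1) = r (2 * k))"
    using power by blast
next
  assume "\<exists>r. invariant_factors scale u r \<and> (\<forall>k\<ge>1. \<exists>n. r k = P ^ n) \<and>
      (\<forall>k\<ge>1. r (2 * k - 1) = r (2 * k))"
  then obtain r where inv: "invariant_factors scale u r"
    and power: "\<forall>k\<ge>1. \<exists>n. r k = P ^ n" and pair: "\<And>k. k \<ge> 1 \<Longrightarrow> r (2 * k - 1) = r (2 * k)"
    by blast
  from inv obtain N bs where chain: "\<And>i. i \<ge> 1 \<Longrightarrow> r (i + 1) dvd r i"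
    and one: "\<And>i. i > N \<Longrightarrow> r i = 1"
    and rep: "represents scale u bs (diag_block_mat (map (\<lambda>i. companion (r i)) [1..<Suc N]))"
    unfolding invariant_factors_def by blast
  obtain e where e: "\<And>k. k \<ge> 1 \<Longrightarrow> r k = P ^ e k"
    using power by metis
  define rs where "rs = map r [1..<Suc N]"
  have monic: "\<forall>r\<in>set rs. lead_coeff r = 1"
    by (auto simp: rs_def e lead_coeff_P_power)
  have "\<exists>bs. represents scale u bs (diag_block_mat (map companion rs))"
    using rep by (auto simp: rs_def comp_def)
  then obtain v where v: "cyclic_decomposition {..<length rs} v ((!) rs)"
    unfolding represents_companions_iff[OF monic] by blast
  have "cyclic_decomposition {..<length rs} v ((!) rs) \<longleftrightarrow>
      cyclic_decomposition {..<length rs} v (\<lambda>k. r (Suc k))"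
    by (intro cyclic_decomposition_cong) (simp add: rs_def del: upt_Suc)
  with v have dec: "cyclic_decomposition {..<N} v (\<lambda>k. r (Suc k))"
    by (simp add: rs_def del: upt_Suc)
  \<comment> \<open>\<open>N\<close> may be odd or exceed the number of nonconstant factors. The
    number of pairs is therefore read off from the first constant factor at an odd position; by
    divisibility all later factors are constant too.\<close>
  define m where "m = (LEAST i. r (Suc (2 * i)) = 1)"
  have m: "r (Suc (2 * m)) = 1"
    unfolding m_def by (rule LeastI[of _ N]) (simp add: one)
  have below: "r (Suc (2 * i)) \<noteq> 1" if "i < m" for i
    using not_less_Least that unfolding m_def by blast
  have beyond: "r k = 1" if "Suc (2 * m) \<le> k" for k
  proof -
    have "r k dvd r (Suc (2 * m))"
      using that
    proof (induction k rule: dec_induct)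
      case (step i)
      then show ?case
        using chain[of i] dvd_trans by auto
    qed simp
    then show ?thesis
      using e[of k] m that P_power_dvd_1[of "e k"] by simp
  qed
  let ?n = "\<lambda>i. e (Suc (2 * i))"
  have "?n i > 0" if "i < m" for i
    using below[OF that] e[of "Suc (2 * i)"] by (cases "?n i = 0") auto
  moreover have "cyclic_decomposition {..<2 * m} (\<lambda>k. if k \<in> {..<N} then v k else 0) (\<lambda>k. r (Suc k))"
    by (rule cyclic_decomposition_pad[OF dec]) (auto simp: one beyond not_less)
  moreover have "r (Suc k) = P ^ ?n (k div 2)" for k
  proof (cases "even k")
    case True
    then show ?thesis
      using e[of "Suc k"] by simp
  next
    case False
    then obtain i where "k = Suc (2 * i)"
      by (auto elim: oddE)
    then show ?thesis
      using pair[of "Suc i"] e[of "Suc (2 * i)"] by simp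
  qed
  ultimately have "paired m ?n (\<lambda>k. if k \<in> {..<N} then v k else 0)"
    by (simp add: paired_def)
  then show "\<exists>m n v. paired m n v" by blast
qed

section \<open>Construction of a from a paired decomposition\<close>

lemma pderiv_pderiv: "pderiv (pderiv f) = (0 :: 'a poly)"
proof (induction f)
  case (pCons c f)
  have "pderiv (pderiv (pCons c f)) = pderiv f + pderiv f + pCons 0 (pderiv (pderiv f))"
    by (simp only: pderiv_pCons pderiv_add add.assoc)
  then show ?case
    by (simp only: pCons.IH add_self_poly add_0_left pCons_0_0)
qed simp

lemma pderiv_power_P: "pderiv (P ^ n) = 0"
  by (induction n) (simp_all add: pderiv_mult pderiv_P)

text \<open>
  The operator \<open>a\<close> is prescribed on each pair of cyclic summands, with generators \<open>x\<close> and \<open>y\<close>,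
  by \<open>a x = y\<close>, \<open>a y = \<alpha> x\<close> and \<open>a u = u a + P(u)\<close>; the last relation forces
  \<open>a (f(u) z) = f(u) (a z) + (P f')(u) z\<close>.
\<close>

lemma paired_imp_twist:
  assumes "paired m n v"
  shows "\<exists>a. Vector_Spaces.linear scale scale a \<and> (\<forall>x. a (a x) = scale \<alpha> x) \<and>
    (\<forall>x. a (u x) + u (a x) = act P x)"
proof -
  define cmb where "cmb g h = (\<Sum>i<m. act (g i) (v (2 * i)) + act (h i) (v (Suc (2 * i))))" for g h
  \<comment> \<open>The right-hand side of \<open>a_comb\<close>, which any operator with the
    required relations must satisfy.\<close>
  define A where "A g h = cmb (\<lambda>i. pderiv (g i) * P + Polynomial.smult \<alpha> (h i))
    (\<lambda>i. g i + pderiv (h i) * P)" for g h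
  have dec: "cyclic_decomposition {..<2 * m} v (\<lambda>k. P ^ n (k div 2))"
    using assms by (simp add: paired_def)
  have cmb_sum: "(\<Sum>k<2 * m. act (f k) (v k)) = cmb (\<lambda>i. f (2 * i)) (\<lambda>i. f (Suc (2 * i)))" for f
    by (simp add: cmb_def sum_lessThan_double)
  have v0: "act (P ^ n i) (v (2 * i)) = 0" "act (P ^ n i) (v (Suc (2 * i))) = 0" if "i < m" for i
  proof -
    have "\<forall>k\<in>{..<2 * m}. act (P ^ n (k div 2)) (v k) = 0"
      using dec by (simp add: cyclic_decomposition_def)
    from bspec[OF this, of "2 * i"] bspec[OF this, of "Suc (2 * i)"]
    show "act (P ^ n i) (v (2 * i)) = 0" "act (P ^ n i) (v (Suc (2 * i))) = 0"
      using that by auto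
  qed
  have surj: "\<exists>g h. x = cmb g h" for x
    using dec unfolding cyclic_decomposition_def cmb_sum by blast
  have free: "P ^ n i dvd g i \<and> P ^ n i dvd h i" if "cmb g h = 0" "i < m" for g h i
  proof -
    let ?f = "\<lambda>k. if even k then g (k div 2) else h (k div 2)"
    have "(\<Sum>k<2 * m. act (?f k) (v k)) = 0"
      unfolding cmb_sum using that by simp
    moreover have "\<forall>f. (\<Sum>k<2 * m. act (f k) (v k)) = 0 \<longrightarrow>
        (\<forall>k\<in>{..<2 * m}. P ^ n (k div 2) dvd f k)"
      using dec by (simp add: cyclic_decomposition_def)
    ultimately have *: "\<forall>k\<in>{..<2 * m}. P ^ n (k div 2) dvd ?f k"
      by (elim allE[of _ ?f] mp)
    from bspec[OF *, of "2 * i"] bspec[OF *, of "Suc (2 * i)"] show ?thesis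
      using that(2) by simp
  qed
  have cmb_add: "cmb g h + cmb g' h' = cmb (\<lambda>i. g i + g' i) (\<lambda>i. h i + h' i)" for g h g' h'
    by (simp add: cmb_def act_add sum.distrib[symmetric] add_ac)
  have act_cmb: "act f (cmb g h) = cmb (\<lambda>i. f * g i) (\<lambda>i. f * h i)" for f g h
    by (simp add: cmb_def act_sum_right act_add_right act_mult)
  have A_add: "A g h + A g' h' = A (\<lambda>i. g i + g' i) (\<lambda>i. h i + h' i)" for g h g' h'
    unfolding A_def cmb_add by (simp add: pderiv_add distrib_right smult_add_right add_ac)
  \<comment> \<open>This makes \<open>A\<close> independent of the chosen coefficients. Relations
    have coefficients divisible by P^(n i), and derivatives of such multiples stay divisible because
    the derivative of P^(n i) is 0.\<close>
  have A_0: "A g h = 0" if "cmb g h = 0" for g h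
  proof -
    have deriv: "P ^ n i dvd pderiv f" if "P ^ n i dvd f" for i f
      using that by (elim dvdE) (simp add: pderiv_mult pderiv_power_P)
    have "act (pderiv (g i) * P + Polynomial.smult \<alpha> (h i)) (v (2 * i)) = 0"
      "act (g i + pderiv (h i) * P) (v (Suc (2 * i))) = 0" if "i < m" for i
      using free[OF \<open>cmb g h = 0\<close> that] deriv
      by (auto intro!: act_dvd_eq_0[OF _ v0(1)[OF that]] act_dvd_eq_0[OF _ v0(2)[OF that]]
          dvd_add dvd_mult2 dvd_smult)
    then show ?thesis
      by (simp add: A_def cmb_def)
  qed
  have A_eq: "A g h = A g' h'" if "cmb g h = cmb g' h'" for g h g' h'
  proof -
    have "A g h + A g' h' = 0"
      unfolding A_add by (rule A_0) (simp add: cmb_add[symmetric] that)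
    then show ?thesis
      by (metis add_eq_0_iff neg_vector)
  qed
  define a where "a x = (SOME y. \<exists>g h. x = cmb g h \<and> y = A g h)" for x
  have a: "a (cmb g h) = A g h" for g h
  proof -
    have "\<exists>y. \<exists>g' h'. cmb g h = cmb g' h' \<and> y = A g' h'"
      by blast
    then have "\<exists>g' h'. cmb g h = cmb g' h' \<and> a (cmb g h) = A g' h'"
      unfolding a_def by (rule someI_ex)
    then show ?thesis
      using A_eq by metis
  qed
  have "a (x + y) = a x + a y" for x y
  proof -
    obtain g h g' h' where "x = cmb g h" "y = cmb g' h'"
      using surj by meson
    then show ?thesis
      by (simp add: cmb_add a A_add)
  qed
  moreover have "a (scale c x) = scale c (a x)" for c x
  proof -
    obtain g h where x: "x = cmb g h"
      using surj by meson
    show ?thesis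
      unfolding x act_const[symmetric] act_cmb a A_def
      by (simp add: pderiv_smult smult_add_right mult.commute[of \<alpha>])
  qed
  ultimately have "Vector_Spaces.linear scale scale a"
    by (intro Vector_Spaces.linear.intro module_hom.intro module_hom_axioms.intro
        vector_space_axioms module_axioms) auto
  moreover have "a (a x) = scale \<alpha> x" for x
  proof -
    obtain g h where x: "x = cmb g h"
      using surj by meson
    \<comment> \<open>Terms with a second derivative or with P' vanish; the terms with a first
      derivative occur twice and cancel.\<close>
    have "a (a x) = cmb (\<lambda>i. Polynomial.smult \<alpha> (g i) +
        (Polynomial.smult \<alpha> (pderiv (h i) * P) + Polynomial.smult \<alpha> (pderiv (h i) * P)))
      (\<lambda>i. Polynomial.smult \<alpha> (h i) + (pderiv (g i) * P + pderiv (g i) * P))"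
      unfolding x a A_def
      by (simp add: pderiv_add pderiv_mult pderiv_smult pderiv_pderiv pderiv_P smult_add_right
          distrib_right add_ac del: add_self_poly)
    also have "\<dots> = cmb (\<lambda>i. [:\<alpha>:] * g i) (\<lambda>i. [:\<alpha>:] * h i)"
      by simp
    also have "\<dots> = scale \<alpha> x"
      unfolding act_cmb[symmetric] x act_const ..
    finally show ?thesis .
  qed
  moreover have "a (u x) + u (a x) = act P x" for x
  proof -
    obtain g h where x: "x = cmb g h"
      using surj by meson
    have deriv: "pderiv ([:0, 1:] * f) = f + [:0, 1:] * pderiv f" for f :: "'a poly"
      by (simp add: pderiv_pCons)
    have u_cmb: "u (cmb g h) = cmb (\<lambda>i. [:0, 1:] * g i) (\<lambda>i. [:0, 1:] * h i)" for g h
      by (rule act_cmb[of "[:0, 1:]", unfolded act_X])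
    \<comment> \<open>The product rule for t f contributes the single term P f; everything else
      occurs twice.\<close>
    have "a (u x) + u (a x) = cmb (\<lambda>i. P * g i +
          ([:0, 1:] * (pderiv (g i) * P + Polynomial.smult \<alpha> (h i)) +
           [:0, 1:] * (pderiv (g i) * P + Polynomial.smult \<alpha> (h i))))
        (\<lambda>i. P * h i + ([:0, 1:] * (g i + pderiv (h i) * P) + [:0, 1:] * (g i + pderiv (h i) * P)))"
      unfolding x u_cmb a A_def cmb_add deriv
      by (intro arg_cong2[where f = cmb] ext)
        (simp_all only: mult_smult_left mult_smult_right distrib_left distrib_right mult_ac add_ac)
    also have "\<dots> = act P x"
      unfolding x act_cmb by simp
    finally show ?thesis .
  qed
  ultimately show ?thesis by blast
qed

end

section \<open>Eigenvalues in the algebraic closure\<close>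

text \<open>The F-linear maps from V to the algebraic closure, that is, the dual space of V after
  extension of scalars.\<close>

definition semilinear_functional ::
  "('a::field \<Rightarrow> 'b::ab_group_add \<Rightarrow> 'b) \<Rightarrow> ('b \<Rightarrow> 'a alg_closure) \<Rightarrow> bool" where
  "semilinear_functional scale \<phi> \<longleftrightarrow>
     (\<forall>x y. \<phi> (x + y) = \<phi> x + \<phi> y) \<and> (\<forall>c x. \<phi> (scale c x) = to_ac c * \<phi> x)"

context vector_space
begin

lemma semilinear_functional_add:
  "semilinear_functional scale \<phi> \<Longrightarrow> \<phi> (x + y) = \<phi> x + \<phi> y"
  by (simp add: semilinear_functional_def)

lemma semilinear_functional_scale:
  "semilinear_functional scale \<phi> \<Longrightarrow> \<phi> (scale c x) = to_ac c * \<phi> x"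
  by (simp add: semilinear_functional_def)

lemma semilinear_functional_0:
  "semilinear_functional scale \<phi> \<Longrightarrow> \<phi> 0 = 0"
  using semilinear_functional_scale[of \<phi> 0 0] by simp

lemma semilinear_functional_sum:
  "semilinear_functional scale \<phi> \<Longrightarrow>
    \<phi> (\<Sum>i\<in>I. scale (s i) (b i)) = (\<Sum>i\<in>I. to_ac (s i) * \<phi> (b i))"
  by (induction I rule: infinite_finite_induct)
    (auto simp: semilinear_functional_0 semilinear_functional_add semilinear_functional_scale)

lemma ordered_basis_iff:
  "ordered_basis scale bs \<longleftrightarrow>
    (\<forall>x. \<exists>c. x = (\<Sum>i<length bs. scale (c i) (bs ! i))) \<and>
    (\<forall>c. (\<Sum>i<length bs. scale (c i) (bs ! i)) = 0 \<longrightarrow> (\<forall>i<length bs. c i = 0))"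
proof -
  have "set [0..<length bs] = {..<length bs}"
    by auto
  then show ?thesis
    using ordered_basis_map_iff[of "[0..<length bs]" "(!) bs"]
    by (simp only: map_nth distinct_upt simp_thms lessThan_iff Ball_def)
qed

lemma semilinear_functional_exists:
  assumes "ordered_basis scale bs"
  shows "\<exists>\<phi>. semilinear_functional scale \<phi> \<and> (\<forall>i<length bs. \<phi> (bs ! i) = c i)"
proof -
  have ind: "independent (set bs)" and sp: "span (set bs) = UNIV" and dist: "distinct bs"
    using assms by (auto simp: ordered_basis_def)
  define \<phi> where
    "\<phi> v = (\<Sum>i<length bs. to_ac (representation (set bs) v (bs ! i)) * c i)" for v
  have "semilinear_functional scale \<phi>"
    unfolding semilinear_functional_def \<phi>_def
    by (simp add: representation_add[OF ind] representation_scale[OF ind] sp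
        distrib_right sum.distrib sum_distrib_left mult.assoc)
  moreover have "\<phi> (bs ! i) = c i" if i: "i < length bs" for i
  proof -
    have "\<phi> (bs ! i) = (\<Sum>j<length bs. if j = i then c j else 0)"
      unfolding \<phi>_def using i dist
      by (intro sum.cong) (auto simp: representation_basis[OF ind] nth_eq_iff_index_eq)
    then show ?thesis
      using i by simp
  qed
  ultimately show ?thesis by blast
qed

lemma semilinear_functional_separates:
  assumes "ordered_basis scale bs" "\<And>\<phi>. semilinear_functional scale \<phi> \<Longrightarrow> \<phi> v = 0"
  shows "v = 0"
proof -
  obtain s where v: "v = (\<Sum>i<length bs. scale (s i) (bs ! i))"
    using assms(1) unfolding ordered_basis_iff by blast
  have "s k = 0" if k: "k < length bs" for k
  proof -
    obtain \<phi> where \<phi>: "semilinear_functional scale \<phi>"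
      and delta: "\<forall>i<length bs. \<phi> (bs ! i) = (if i = k then 1 else 0)"
      using semilinear_functional_exists[OF assms(1), of "\<lambda>i. if i = k then 1 else 0"] by blast
    have "\<phi> v = (\<Sum>i<length bs. to_ac (s i) * \<phi> (bs ! i))"
      unfolding v by (rule semilinear_functional_sum[OF \<phi>])
    also have "\<dots> = (\<Sum>i<length bs. if i = k then to_ac (s i) else 0)"
      using delta by (intro sum.cong) auto
    also have "\<dots> = to_ac (s k)"
      using k by simp
    finally show ?thesis
      using assms(2)[OF \<phi>] by simp
  qed
  then show ?thesis
    unfolding v by simp
qed

end

context linear_endo
begin

text \<open>
  Left eigenvectors of the extended matrix are the semilinear eigenfunctionals of \<open>u\<close>.
\<close>

lemma eigenvalue_iff_functional:
  assumes rep: "represents scale u bs M"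
  shows "eigenvalue (map_mat to_ac M) x \<longleftrightarrow>
    (\<exists>\<phi>. semilinear_functional scale \<phi> \<and> (\<exists>v. \<phi> v \<noteq> 0) \<and> (\<forall>v. \<phi> (u v) = x * \<phi> v))"
proof -
  let ?n = "length bs"
  let ?B = "map_mat to_ac M"
  have basis: "ordered_basis scale bs" and M: "M \<in> carrier_mat ?n ?n"
    and col: "\<And>j. j < ?n \<Longrightarrow> u (bs ! j) = (\<Sum>i<?n. scale (M $$ (i, j)) (bs ! i))"
    using rep by (auto simp: represents_def)
  have B: "?B \<in> carrier_mat ?n ?n" "transpose_mat ?B \<in> carrier_mat ?n ?n"
    using M by auto
  have mult: "(transpose_mat ?B *\<^sub>v c) $ j = (\<Sum>i<?n. to_ac (M $$ (i, j)) * c $ i)"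
    if "c \<in> carrier_vec ?n" "j < ?n" for c j
    using that M by (simp add: scalar_prod_def lessThan_atLeast0 carrier_matD carrier_vecD)
  \<comment> \<open>For the transpose, an eigenvector is the list of values of a functional on the
    basis.\<close>
  have "eigenvalue ?B x \<longleftrightarrow> eigenvalue (transpose_mat ?B) x"
    using B by (simp add: eigenvalue_root_char_poly[of _ ?n] char_poly_transpose_mat[of _ ?n])
  also have "\<dots> \<longleftrightarrow> (\<exists>c. (\<exists>i<?n. c i \<noteq> 0) \<and>
      (\<forall>j<?n. (\<Sum>i<?n. to_ac (M $$ (i, j)) * c i) = x * c j))" (is "_ \<longleftrightarrow> ?C")
  proof
    assume "eigenvalue (transpose_mat ?B) x"
    then obtain c where c: "c \<in> carrier_vec ?n" "c \<noteq> 0\<^sub>v ?n" "transpose_mat ?B *\<^sub>v c = x \<cdot>\<^sub>v c"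
      using B by (auto simp: eigenvalue_def eigenvector_def)
    have "\<exists>i<?n. c $ i \<noteq> 0"
      using c(1,2) by (metis carrier_vecD eq_vecI index_zero_vec(1) index_zero_vec(2))
    moreover have "(\<Sum>i<?n. to_ac (M $$ (i, j)) * c $ i) = x * c $ j" if "j < ?n" for j
      using mult[OF c(1) that] that c(1) unfolding c(3) by simp
    ultimately show ?C
      by (intro exI[of _ "($) c"]) auto
  next
    assume ?C
    then obtain c i where i: "i < ?n" "c i \<noteq> 0"
      and c: "\<And>j. j < ?n \<Longrightarrow> (\<Sum>i<?n. to_ac (M $$ (i, j)) * c i) = x * c j"
      by blast
    have C: "Matrix.vec ?n c \<in> carrier_vec ?n"
      by simp
    have "Matrix.vec ?n c \<noteq> 0\<^sub>v ?n"
      using i by (metis index_vec index_zero_vec(1))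
    moreover have "transpose_mat ?B *\<^sub>v Matrix.vec ?n c = x \<cdot>\<^sub>v Matrix.vec ?n c"
    proof (rule eq_vecI)
      fix j
      assume "j < dim_vec (x \<cdot>\<^sub>v Matrix.vec ?n c)"
      then have j: "j < ?n" by simp
      show "(transpose_mat ?B *\<^sub>v Matrix.vec ?n c) $ j = (x \<cdot>\<^sub>v Matrix.vec ?n c) $ j"
        unfolding mult[OF C j] using c[OF j] j by simp
    qed (use M in auto)
    ultimately show "eigenvalue (transpose_mat ?B) x"
      unfolding eigenvalue_def eigenvector_def
      using B C by (intro exI[of _ "Matrix.vec ?n c"]) auto
  qed
  also have "\<dots> \<longleftrightarrow>
    (\<exists>\<phi>. semilinear_functional scale \<phi> \<and> (\<exists>v. \<phi> v \<noteq> 0) \<and> (\<forall>v. \<phi> (u v) = x * \<phi> v))" (is "_ \<longleftrightarrow> ?F")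
  proof
    assume ?C
    then obtain c i where i: "i < ?n" "c i \<noteq> 0"
      and c: "\<And>j. j < ?n \<Longrightarrow> (\<Sum>i<?n. to_ac (M $$ (i, j)) * c i) = x * c j"
      by blast
    obtain \<phi> where \<phi>: "semilinear_functional scale \<phi>" and \<phi>c: "\<And>i. i < ?n \<Longrightarrow> \<phi> (bs ! i) = c i"
      using semilinear_functional_exists[OF basis, of c] by blast
    have \<phi>u: "\<phi> (u (bs ! j)) = x * c j" if "j < ?n" for j
      unfolding col[OF that] semilinear_functional_sum[OF \<phi>]
      using c[OF that] \<phi>c by simp
    have "\<phi> (u v) = x * \<phi> v" for v
    proof -
      obtain s where v: "v = (\<Sum>i<?n. scale (s i) (bs ! i))"
        using basis unfolding ordered_basis_iff by blast
      have "\<phi> (u v) = (\<Sum>i<?n. to_ac (s i) * \<phi> (u (bs ! i)))"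
        unfolding v endo.sum endo.scale by (rule semilinear_functional_sum[OF \<phi>])
      also have "\<dots> = x * (\<Sum>i<?n. to_ac (s i) * \<phi> (bs ! i))"
        by (simp add: \<phi>u \<phi>c sum_distrib_left mult.left_commute)
      also have "\<dots> = x * \<phi> v"
        unfolding v semilinear_functional_sum[OF \<phi>] ..
      finally show ?thesis .
    qed
    moreover have "\<phi> (bs ! i) \<noteq> 0"
      using i \<phi>c by simp
    ultimately show ?F
      using \<phi> by blast
  next
    assume ?F
    then obtain \<phi> v where \<phi>: "semilinear_functional scale \<phi>" and v0: "\<phi> v \<noteq> 0"
      and \<phi>u: "\<And>v. \<phi> (u v) = x * \<phi> v"
      by blast
    obtain s where v: "v = (\<Sum>i<?n. scale (s i) (bs ! i))"
      using basis unfolding ordered_basis_iff by blast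
    have "(\<Sum>i<?n. to_ac (s i) * \<phi> (bs ! i)) \<noteq> 0"
      using v0 unfolding v semilinear_functional_sum[OF \<phi>] .
    then have "\<exists>i<?n. \<phi> (bs ! i) \<noteq> 0"
      by (metis (no_types, lifting) lessThan_iff mult_zero_right sum.neutral)
    moreover have "(\<Sum>i<?n. to_ac (M $$ (i, j)) * \<phi> (bs ! i)) = x * \<phi> (bs ! j)" if "j < ?n" for j
      using \<phi>u[of "bs ! j"] unfolding col[OF that] semilinear_functional_sum[OF \<phi>] .
    ultimately show ?C
      by (intro exI[of _ "\<lambda>i. \<phi> (bs ! i)"]) simp
  qed
  finally show ?thesis .
qed

text \<open>\<open>d_exceptional\<close> speaks about all representing matrices and would be vacuous
  if there were none.\<close>

lemma represents_exists:
  assumes B: "finite B" "span B = UNIV"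
  shows "\<exists>bs M. represents scale u bs M"
proof -
  obtain C where C: "independent C" "UNIV \<subseteq> span C"
    using maximal_independent_subset[of UNIV] by metis
  have "finite C"
    using independent_span_bound[OF B(1) C(1)] B(2) by simp
  then obtain bs where bs: "set bs = C" "distinct bs"
    using finite_distinct_list by blast
  have basis: "ordered_basis scale bs"
    using bs C by (auto simp: ordered_basis_def)
  have "\<exists>c. u (bs ! j) = (\<Sum>i<length bs. scale (c i) (bs ! i))" for j
    using basis unfolding ordered_basis_iff by blast
  then obtain c where c: "\<And>j. u (bs ! j) = (\<Sum>i<length bs. scale (c j i) (bs ! i))"
    by metis
  have "represents scale u bs (mat (length bs) (length bs) (\<lambda>(i, j). c j i))"
    using basis c by (auto simp: represents_def)
  then show ?thesis by blast
qed

text \<open>The first card B + 1 iterates of a vector are dependent as a family, even if some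
  coincide, so each vector is killed by some nonzero polynomial. The product over the spanning set
  kills everything.\<close>

lemma annihilating_poly_exists:
  assumes B: "finite B" "span B = UNIV"
  shows "\<exists>\<mu>. \<mu> \<noteq> 0 \<and> (\<forall>v. act \<mu> v = 0)"
proof -
  have "\<exists>f. f \<noteq> 0 \<and> act f v = 0" for v
  proof -
    let ?m = "Suc (card B)"
    have "\<exists>c i. (\<Sum>i<?m. scale (c i) ((u ^^ i) v)) = 0 \<and> i < ?m \<and> c i \<noteq> 0"
    proof (rule ccontr)
      assume "\<not> ?thesis"
      then have "?m \<le> card B"
        by (intro independent_family_le_card[where x = "\<lambda>i. (u ^^ i) v", OF _ B]) blast
      then show False by simp
    qed
    then obtain c i where c: "(\<Sum>i<?m. scale (c i) ((u ^^ i) v)) = 0" "i < ?m" "c i \<noteq> 0"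
      by blast
    let ?f = "\<Sum>j<?m. Polynomial.monom (c j) j"
    have "act ?f v = 0"
      using c(1) by (simp only: act_sum act_monom)
    moreover have "coeff ?f i = c i"
      using c(2) by (simp only: coeff_sum coeff_monom) (simp add: sum.delta del: sum.lessThan_Suc)
    ultimately show ?thesis
      using c(3) by (intro exI[of _ ?f]) (metis coeff_0)
  qed
  then obtain f where f: "\<And>v. f v \<noteq> 0" "\<And>v. act (f v) v = 0"
    by metis
  let ?\<mu> = "\<Prod>b\<in>B. f b"
  have "act ?\<mu> v = 0" for v
  proof -
    have "subspace {v. act ?\<mu> v = 0}"
      by (auto simp: subspace_def act_add_right act_scale_right)
    moreover have "b \<in> {v. act ?\<mu> v = 0}" if "b \<in> B" for b
    proof -
      have "f b dvd ?\<mu>"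
        by (rule dvd_prodI[OF B(1) that])
      then show ?thesis
        using act_dvd_eq_0[OF _ f(2)] by blast
    qed
    ultimately have "span B \<subseteq> {v. act ?\<mu> v = 0}"
      by (intro span_minimal) auto
    then show ?thesis
      using B(2) by auto
  qed
  moreover have "?\<mu> \<noteq> 0"
    using f(1) B(1) by simp
  ultimately show ?thesis by blast
qed

end

text \<open>
  Polynomials over the algebraic closure act on functions \<open>'b \<Rightarrow> 'a alg_closure\<close> through
  \<open>\<phi> \<mapsto> \<phi> \<circ> u\<close>; this replaces an extension of scalars.
\<close>

locale dual_endo = linear_endo scale u
  for scale :: "'a::field \<Rightarrow> 'b::ab_group_add \<Rightarrow> 'b" and u
begin

sublocale dual: linear_endo "\<lambda>k \<phi> v. k * \<phi> v :: 'a alg_closure" "\<lambda>\<phi> v. \<phi> (u v)"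
proof -
  have "vector_space (\<lambda>k (\<phi> :: 'b \<Rightarrow> 'a alg_closure) v. k * \<phi> v)"
    by unfold_locales (auto simp: fun_eq_iff algebra_simps)
  then show "linear_endo (\<lambda>k \<phi> v. k * \<phi> v :: 'a alg_closure) (\<lambda>\<phi> v. \<phi> (u v))"
    by (intro linear_endo.intro linear_endo_axioms.intro Vector_Spaces.linear.intro
        module_hom.intro module_hom_axioms.intro)
      (auto simp: module_iff_vector_space fun_eq_iff)
qed

lemma semilinear_functional_dual_act:
  assumes "semilinear_functional scale \<phi>"
  shows "semilinear_functional scale (dual.act f \<phi>)"
proof (induction f)
  case 0
  then show ?case
    by (simp add: semilinear_functional_def)
next
  case (pCons c f)
  then show ?case
    using assms unfolding dual.act_pCons semilinear_functional_def
    by (simp add: endo.add endo.scale algebra_simps)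
qed

lemma dual_act_linear: "dual.act [:- x, 1:] \<phi> = (\<lambda>v. \<phi> (u v) - x * \<phi> v)"
  by (simp add: dual.act_pCons fun_eq_iff)

text \<open>Linear factors are peeled off one at a time. If x differs from s, the remaining product
  sends the functional to an eigenfunctional for x, which is zero; if x = s, the exponent grows by
  one.\<close>

lemma dual_act_eq_0_cases:
  assumes eig: "\<And>x \<phi>. semilinear_functional scale \<phi> \<Longrightarrow> (\<And>v. \<phi> (u v) = x * \<phi> v) \<Longrightarrow>
    x \<noteq> s \<Longrightarrow> \<phi> = 0"
  shows "\<exists>k. \<forall>\<phi>. semilinear_functional scale \<phi> \<longrightarrow>
    dual.act (\<Prod>x\<in>#A. [:- x, 1:]) \<phi> = 0 \<longrightarrow> dual.act ([:- s, 1:] ^ k) \<phi> = 0"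
proof (induction A)
  case empty
  show ?case
    by (intro exI[of _ 0]) simp
next
  case (add x A)
  let ?g = "\<Prod>x\<in>#A. [:- x, 1:]"
  obtain k where k: "\<And>\<phi>. semilinear_functional scale \<phi> \<Longrightarrow> dual.act ?g \<phi> = 0 \<Longrightarrow>
      dual.act ([:- s, 1:] ^ k) \<phi> = 0"
    using add.IH by blast
  show ?case
  proof (cases "x = s")
    case True
    have "dual.act ([:- s, 1:] ^ Suc k) \<phi> = 0"
      if \<phi>: "semilinear_functional scale \<phi>" and 0: "dual.act (?g * [:- s, 1:]) \<phi> = 0" for \<phi>
      using k[OF semilinear_functional_dual_act[OF \<phi>], of "[:- s, 1:]"] 0
      unfolding power_Suc2 dual.act_mult by blast
    moreover have "(\<Prod>x\<in>#add_mset x A. [:- x, 1:]) = ?g * [:- s, 1:]"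
      by (simp only: True image_mset_add_mset prod_mset.add_mset mult.commute)
    ultimately show ?thesis
      by (intro exI[of _ "Suc k"]) metis
  next
    case False
    have "dual.act ?g \<phi> = 0"
      if \<phi>: "semilinear_functional scale \<phi>" and 0: "dual.act ([:- x, 1:] * ?g) \<phi> = 0" for \<phi>
    proof (rule eig[OF semilinear_functional_dual_act[OF \<phi>] _ False])
      show "dual.act ?g \<phi> (u v) = x * dual.act ?g \<phi> v" for v
        using fun_cong[OF 0[unfolded dual.act_mult dual_act_linear], of v] by simp
    qed
    moreover have "(\<Prod>x\<in>#add_mset x A. [:- x, 1:]) = [:- x, 1:] * ?g"
      by (simp only: image_mset_add_mset prod_mset.add_mset)
    ultimately show ?thesis
      using k by (intro exI[of _ k]) metis
  qed
qed

end

section \<open>Exceptional eigenvalues and nilpotency of P(u)\<close>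

context char2_endo
begin

sublocale dual_endo scale u ..

lemma add_self_ac [simp]: "x + x = (0 :: 'a alg_closure)"
  by (rule add_self_char2) (simp add: char2)

lemma functional_act_P:
  assumes "semilinear_functional scale \<phi>"
  shows "\<phi> (act P v) = \<phi> (u (u v)) - to_ac \<gamma> * \<phi> v"
proof -
  have "act P v = scale (- \<gamma>) v + u (u v)"
    by (simp add: P act_pCons endo.zero)
  then show ?thesis
    using assms
    by (simp only: semilinear_functional_add semilinear_functional_scale to_ac_minus)
      (simp add: algebra_simps)
qed

text \<open>On an eigenfunctional for x, P(u) acts as multiplication by x^2 - \<gamma>, and the N-th
  power of this number must vanish.\<close>

lemma eigenvalue_square:
  assumes "represents scale u bs M" "eigenvalue (map_mat to_ac M) x" and nil: "\<And>v. act (P ^ N) v = 0"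
  shows "x\<^sup>2 = to_ac \<gamma>"
proof -
  obtain \<phi> v where \<phi>: "semilinear_functional scale \<phi>" and v: "\<phi> v \<noteq> 0"
    and eig: "\<And>v. \<phi> (u v) = x * \<phi> v"
    using assms(1,2) eigenvalue_iff_functional by blast
  have "\<phi> (act P v) = (x\<^sup>2 - to_ac \<gamma>) * \<phi> v" for v
    by (simp add: functional_act_P[OF \<phi>] eig power2_eq_square algebra_simps)
  then have "\<phi> (act (P ^ k) v) = (x\<^sup>2 - to_ac \<gamma>) ^ k * \<phi> v" for k v
    by (induction k) (simp_all add: act_mult)
  from this[of N v] have "(x\<^sup>2 - to_ac \<gamma>) ^ N = 0"
    using v by (simp add: nil semilinear_functional_0[OF \<phi>])
  then show ?thesis by simp
qed

text \<open>All eigenvalues equal the unique square root s of \<gamma>. Splitting an annihilating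
  polynomial over the closure leaves a power of t - s that kills every functional, and P = (t - s)^2
  carries this back to a power of P(u) on V.\<close>

lemma nilpotent_if_eigenvalues:
  assumes B: "finite B" "span B = UNIV"
    and eig: "\<And>bs M x. represents scale u bs M \<Longrightarrow> eigenvalue (map_mat to_ac M) x \<Longrightarrow>
      x\<^sup>2 = to_ac \<gamma>"
  shows "\<exists>N. \<forall>v. act (P ^ N) v = 0"
proof -
  obtain s where s: "s\<^sup>2 = to_ac \<gamma>"
    using nth_root_exists[of 2 "to_ac \<gamma>"] by auto
  have s_unique: "x = s" if "x\<^sup>2 = to_ac \<gamma>" for x
  proof -
    have "(x - s)\<^sup>2 = x\<^sup>2 + s\<^sup>2 - (x * s + x * s)"
      by (simp add: power2_eq_square algebra_simps del: add_self_ac)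
    also have "\<dots> = 0"
      by (simp only: that s add_self_ac diff_0_right)
    finally show ?thesis by simp
  qed
  obtain bs M where rep: "represents scale u bs M"
    using represents_exists[OF B] by blast
  have eig': "\<phi> = 0"
    if "semilinear_functional scale \<phi>" "\<And>v. \<phi> (u v) = x * \<phi> v" "x \<noteq> s" for x \<phi>
  proof (rule ccontr)
    assume "\<phi> \<noteq> 0"
    then obtain v where "\<phi> v \<noteq> 0"
      by (auto simp: fun_eq_iff)
    then have "eigenvalue (map_mat to_ac M) x"
      using that eigenvalue_iff_functional[OF rep] by blast
    then show False
      using eig[OF rep] s_unique that(3) by blast
  qed
  obtain \<mu> where \<mu>: "\<mu> \<noteq> 0" "\<And>v. act \<mu> v = 0"
    using annihilating_poly_exists[OF B] by blast
  let ?\<mu> = "map_poly to_ac \<mu>"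
  have dual_map: "dual.act (map_poly to_ac f) \<phi> = (\<lambda>v. \<phi> (act f v))"
    if \<phi>: "semilinear_functional scale \<phi>" for f \<phi>
  proof (induction f)
    case 0
    then show ?case
      using semilinear_functional_0[OF \<phi>] by (simp add: fun_eq_iff)
  next
    case (pCons c f)
    have "act f (u v) = u (act f v)" for v
      using act_commute[of f "[:0, 1:]" v] by simp
    then show ?case
      using pCons
      by (simp add: map_poly_pCons dual.act_pCons act_pCons fun_eq_iff
          semilinear_functional_add[OF \<phi>] semilinear_functional_scale[OF \<phi>])
  qed
  have "?\<mu> \<noteq> 0"
    using \<mu>(1) by (simp add: map_poly_eq_0_iff)
  then obtain A where A: "?\<mu> = Polynomial.smult (lead_coeff ?\<mu>) (\<Prod>x\<in>#A. [:- x, 1:])"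
    using alg_closed_imp_factorization[of ?\<mu>] by metis
  have prod_0: "dual.act (\<Prod>x\<in>#A. [:- x, 1:]) \<phi> = 0" if \<phi>: "semilinear_functional scale \<phi>" for \<phi>
  proof -
    let ?g = "\<Prod>x\<in>#A. [:- x, 1:]"
    have "dual.act ?\<mu> \<phi> = 0"
      by (simp add: dual_map[OF \<phi>] \<mu>(2) semilinear_functional_0[OF \<phi>] fun_eq_iff)
    then have "dual.act (Polynomial.smult (lead_coeff ?\<mu>) ?g) \<phi> = 0"
      using A by metis
    then have "lead_coeff ?\<mu> * dual.act ?g \<phi> v = 0" for v
      unfolding dual.act_smult by (auto simp: fun_eq_iff)
    then show ?thesis
      using \<open>?\<mu> \<noteq> 0\<close> by (auto simp: fun_eq_iff)
  qed
  have "\<exists>k. \<forall>\<phi>. semilinear_functional scale \<phi> \<longrightarrow>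
    dual.act (\<Prod>x\<in>#A. [:- x, 1:]) \<phi> = 0 \<longrightarrow> dual.act ([:- s, 1:] ^ k) \<phi> = 0"
  proof (rule dual_act_eq_0_cases)
    fix x \<phi>
    assume "semilinear_functional scale \<phi>" "\<And>v. \<phi> (u v) = x * \<phi> v" "x \<noteq> s"
    then show "\<phi> = 0" by (rule eig')
  qed
  then obtain k where k: "\<And>\<phi>. semilinear_functional scale \<phi> \<Longrightarrow> dual.act ([:- s, 1:] ^ k) \<phi> = 0"
    using prod_0 by blast
  have square: "dual.act ([:- s, 1:]\<^sup>2) \<phi> = (\<lambda>v. \<phi> (act P v))"
    if \<phi>: "semilinear_functional scale \<phi>" for \<phi>
  proof -
    have "[:- s, 1:]\<^sup>2 = [:s\<^sup>2, - (s + s), 1:]"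
      by (simp add: power2_eq_square del: add_self_ac)
    \<comment> \<open>The doubled summand is zero; it only changes the sign of \<gamma> to match the
      constant coefficient of P.\<close>
    also have "\<dots> = [:- to_ac \<gamma> + (to_ac \<gamma> + to_ac \<gamma>), 0, 1:]"
      unfolding s add_self_ac[of s] by (simp del: add_self_ac)
    also have "\<dots> = map_poly to_ac P"
      unfolding add_self_ac by (simp add: P map_poly_pCons)
    finally show ?thesis
      using dual_map[OF \<phi>] by simp
  qed
  have powers: "dual.act (([:- s, 1:]\<^sup>2) ^ j) \<phi> = (\<lambda>v. \<phi> (act (P ^ j) v))"
    if \<phi>: "semilinear_functional scale \<phi>" for \<phi> j
  proof (induction j)
    case (Suc j)
    have "dual.act ([:- s, 1:]\<^sup>2 ^ Suc j) \<phi> = dual.act ([:- s, 1:]\<^sup>2) (dual.act ([:- s, 1:]\<^sup>2 ^ j) \<phi>)"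
      by (simp only: power_Suc dual.act_mult)
    also have "\<dots> = (\<lambda>v. dual.act ([:- s, 1:]\<^sup>2 ^ j) \<phi> (act P v))"
      by (rule square[OF semilinear_functional_dual_act[OF \<phi>]])
    also have "\<dots> = (\<lambda>v. \<phi> (act (P ^ Suc j) v))"
      unfolding Suc by (simp only: power_Suc2 act_mult)
    finally show ?case .
  qed simp
  have "act (P ^ k) v = 0" for v
  proof (rule semilinear_functional_separates)
    show "ordered_basis scale bs"
      using rep by (simp add: represents_def)
    fix \<phi>
    assume \<phi>: "semilinear_functional scale \<phi>"
    have "dual.act ([:- s, 1:]\<^sup>2 ^ k) \<phi> = dual.act ([:- s, 1:] ^ k) (dual.act ([:- s, 1:] ^ k) \<phi>)"
      by (simp only: power2_eq_square power_mult_distrib dual.act_mult)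
    also have "\<dots> = 0"
      by (simp add: k[OF \<phi>])
    finally show "\<phi> (act (P ^ k) v) = 0"
      unfolding powers[OF \<phi>] by (simp add: fun_eq_iff)
  qed
  then show ?thesis by blast
qed

end

section \<open>Differences of square roots\<close>

lemma irreducible_imp_not_square:
  fixes \<alpha> :: "'a::field"
  assumes "CHAR('a) = 2" "Factorial_Ring.irreducible [:- \<alpha>, 0, 1:]"
  shows "\<alpha> \<noteq> c\<^sup>2"
proof
  assume \<alpha>: "\<alpha> = c\<^sup>2"
  have "[:c, 1:] * [:c, 1:] = [:c\<^sup>2, c + c, 1:]"
    by (simp add: power2_eq_square)
  also have "\<dots> = [:- \<alpha>, 0, 1:]"
    by (simp only: \<alpha> neg_char2[OF assms(1)] add_self_char2[OF assms(1)])
  finally have "[:- \<alpha>, 0, 1:] = [:c, 1:] * [:c, 1:]" ..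
  then have "[:c, 1:] dvd 1"
    using irreducibleD[OF assms(2)] by blast
  then show False
    using dvd_imp_degree_le[of "[:c, 1:]" 1] by simp
qed

lemma Root_quadratic: "Root [:- \<alpha>, 0, 1:] = {x. x\<^sup>2 = to_ac \<alpha>}"
  by (auto simp: Root_def map_poly_pCons power2_eq_square)

text \<open>Squaring is additive and injective, so the root of t^2 - \<alpha> can only be x + y t
  with t the square root of \<beta>.\<close>

lemma splitting_field_subset:
  fixes \<alpha> \<beta> :: "'a::field"
  assumes char2: "CHAR('a) = 2" and \<alpha>: "\<alpha> = x\<^sup>2 + \<beta> * y\<^sup>2"
  shows "splitting_field [:- \<alpha>, 0, 1:] \<subseteq> splitting_field [:- \<beta>, 0, 1:]"
proof
  let ?R = "ring_of_type_algebra :: 'a alg_closure ring"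
  let ?K = "splitting_field [:- \<beta>, 0, 1:]"
  have char2': "CHAR('a alg_closure) = 2"
    by (simp add: char2)
  have base: "range to_ac \<subseteq> ?K" "Root [:- \<beta>, 0, 1:] \<subseteq> ?K"
    unfolding splitting_field_def by (auto intro: generate_field.incl)
  have add: "h + k \<in> ?K" if "h \<in> ?K" "k \<in> ?K" for h k
    using generate_field.eng_add[of h ?R _ k] that
    by (simp add: splitting_field_def ring_of_type_algebra_def)
  have mult: "h * k \<in> ?K" if "h \<in> ?K" "k \<in> ?K" for h k
    using generate_field.eng_mult[of h ?R _ k] that
    by (simp add: splitting_field_def ring_of_type_algebra_def)
  have root: "Root [:- \<alpha>, 0, 1:] \<subseteq> ?K"
  proof
    fix s
    assume "s \<in> Root [:- \<alpha>, 0, 1:]"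
    then have s: "s\<^sup>2 = to_ac \<alpha>"
      by (simp add: Root_quadratic)
    obtain t where t: "t\<^sup>2 = to_ac \<beta>"
      using nth_root_exists[of 2 "to_ac \<beta>"] by auto
    have "(s + (to_ac x + to_ac y * t))\<^sup>2 = to_ac \<alpha> + to_ac \<alpha>"
      unfolding add_square_char2[OF char2'] power_mult_distrib s t
      by (simp add: \<alpha> mult.commute)
    also have "\<dots> = 0"
      by (rule add_self_char2[OF char2'])
    finally have "s = to_ac x + to_ac y * t"
      using neg_char2[OF char2', of "to_ac x + to_ac y * t"] by (simp add: add_eq_0_iff2)
    moreover have "t \<in> ?K"
      using base(2) t by (auto simp: Root_quadratic)
    ultimately show "s \<in> ?K"
      using base(1) by (auto intro!: add mult)
  qed
  fix z
  assume "z \<in> splitting_field [:- \<alpha>, 0, 1:]"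
  then have "z \<in> generate_field ?R (range to_ac \<union> Root [:- \<alpha>, 0, 1:])"
    by (simp add: splitting_field_def)
  then show "z \<in> ?K"
  proof (induction rule: generate_field.induct)
    case (incl h)
    then show ?case
      using base(1) root by blast
  qed (auto simp: splitting_field_def intro: generate_field.intros)
qed

text \<open>y = 0 would make \<alpha> a square. Otherwise the equation can be solved for \<beta> in
  the same shape, and the two inclusions make the splitting fields equal.\<close>

lemma not_norm:
  fixes \<alpha> \<beta> :: "'a::field"
  assumes char2: "CHAR('a) = 2"
    and irr: "Factorial_Ring.irreducible [:- \<alpha>, 0, 1:]"
    and neq: "splitting_field [:- \<alpha>, 0, 1:] \<noteq> splitting_field [:- \<beta>, 0, 1:]"
  shows "\<alpha> \<noteq> x\<^sup>2 + \<beta> * y\<^sup>2"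
proof
  assume \<alpha>: "\<alpha> = x\<^sup>2 + \<beta> * y\<^sup>2"
  then have "y \<noteq> 0"
    using irreducible_imp_not_square[OF char2 irr, of x] by auto
  have "x\<^sup>2 + \<alpha> = \<beta> * y\<^sup>2 + (x\<^sup>2 + x\<^sup>2)"
    by (simp only: \<alpha> add_ac)
  also have "\<dots> = \<beta> * y\<^sup>2"
    by (simp only: add_self_char2[OF char2] add_0_right)
  finally have "\<beta> = (x / y)\<^sup>2 + \<alpha> * (1 / y)\<^sup>2"
    using \<open>y \<noteq> 0\<close> by (simp add: power_divide field_simps)
  then show False
    using splitting_field_subset[OF char2 \<alpha>] splitting_field_subset[OF char2] neq by blast
qed

text \<open>Two quadratic steps: \<gamma> is not a square, and \<alpha> is not of the form x^2 +
  \<gamma> y^2. Values of that form are closed under products, so a zero with D nonzero would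
  exhibit \<alpha> = A D / D^2 as one of them.\<close>

lemma biquadratic_norm_eq_0:
  fixes \<alpha> \<beta> :: "'a::field"
  assumes char2: "CHAR('a) = 2"
    and irr: "Factorial_Ring.irreducible [:- \<alpha>, 0, 1:]" "Factorial_Ring.irreducible [:- \<beta>, 0, 1:]"
    and neq: "splitting_field [:- \<alpha>, 0, 1:] \<noteq> splitting_field [:- \<beta>, 0, 1:]"
    and 0: "c0\<^sup>2 + (\<alpha> + \<beta>) * c1\<^sup>2 + \<alpha> * (c2\<^sup>2 + (\<alpha> + \<beta>) * c3\<^sup>2) = 0"
  shows "c0 = 0 \<and> c1 = 0 \<and> c2 = 0 \<and> c3 = 0"
proof -
  define \<gamma> where "\<gamma> = \<alpha> + \<beta>"
  note self = add_self_char2[OF char2]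
  have \<gamma>: "\<gamma> \<noteq> c\<^sup>2" for c
  proof
    assume "\<gamma> = c\<^sup>2"
    have "\<alpha> = \<alpha> + (\<beta> + \<beta>)"
      by (simp only: self add_0_right)
    also have "\<dots> = c\<^sup>2 + \<beta> * 1\<^sup>2"
      unfolding \<open>\<gamma> = c\<^sup>2\<close>[symmetric] \<gamma>_def by (simp add: add.assoc)
    finally show False
      using not_norm[OF char2 irr(1) neq] by blast
  qed
  have \<alpha>: "\<alpha> \<noteq> x\<^sup>2 + \<gamma> * y\<^sup>2" for x y
  proof
    assume eq: "\<alpha> = x\<^sup>2 + \<gamma> * y\<^sup>2"
    \<comment> \<open>Writing \<gamma> = \<alpha> + \<beta> and collecting the multiples of \<alpha>
      gives the factor 1 + y^2 = (1 + y)^2. It vanishes only for y = 1, and then \<beta> is a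
      square.\<close>
    have "\<alpha> * (1 + y)\<^sup>2 = \<alpha> + \<alpha> * y\<^sup>2"
      by (simp add: add_square_char2[OF char2] distrib_left)
    also have "\<dots> = x\<^sup>2 + \<beta> * y\<^sup>2 + (\<alpha> * y\<^sup>2 + \<alpha> * y\<^sup>2)"
      by (subst (1) eq) (simp only: \<gamma>_def distrib_right add_ac)
    finally have *: "\<alpha> * (1 + y)\<^sup>2 = x\<^sup>2 + \<beta> * y\<^sup>2"
      by (simp only: self add_0_right)
    show False
    proof (cases "1 + y = 0")
      case True
      then have "y = 1"
        using neg_char2[OF char2, of "1 :: 'a"] by (simp add: add_eq_0_iff)
      then have "x\<^sup>2 + \<beta> = \<alpha> * (1 + y)\<^sup>2"
        unfolding * by simp
      also have "\<dots> = 0"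
        unfolding True by simp
      finally have "x\<^sup>2 + \<beta> = 0" .
      then have "\<beta> = x\<^sup>2"
        using neg_char2[OF char2, of "x\<^sup>2"] by (simp add: add_eq_0_iff)
      then show False
        using irreducible_imp_not_square[OF char2 irr(2)] by blast
    next
      case False
      then have "\<alpha> = (x / (1 + y))\<^sup>2 + \<beta> * (y / (1 + y))\<^sup>2"
        using * by (simp add: power_divide field_simps)
      then show False
        using not_norm[OF char2 irr(1) neq] by blast
    qed
  qed
  have quadratic: "c = 0 \<and> d = 0" if "c\<^sup>2 + \<gamma> * d\<^sup>2 = 0" for c d
  proof (cases "d = 0")
    case False
    have "\<gamma> * d\<^sup>2 = c\<^sup>2"
      using that neg_char2[OF char2, of "c\<^sup>2"] by (simp add: add_eq_0_iff)
    then have "\<gamma> = (c / d)\<^sup>2"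
      using False by (simp add: power_divide field_simps)
    then show ?thesis
      using \<gamma> by blast
  qed (use that in simp)
  define A D where "A = c0\<^sup>2 + \<gamma> * c1\<^sup>2" and "D = c2\<^sup>2 + \<gamma> * c3\<^sup>2"
  have AD: "A = \<alpha> * D"
  proof -
    have "A = - (\<alpha> * D)"
      using 0 by (simp add: A_def D_def \<gamma>_def eq_neg_iff_add_eq_0)
    then show ?thesis
      by (simp only: neg_char2[OF char2])
  qed
  have "D = 0"
  proof (rule ccontr)
    assume "D \<noteq> 0"
    have "\<alpha> * D\<^sup>2 = A * D"
      by (simp add: AD power2_eq_square)
    also have "\<dots> = (c0 * c2)\<^sup>2 + (\<gamma> * c1 * c3)\<^sup>2 + \<gamma> * ((c0 * c3)\<^sup>2 + (c1 * c2)\<^sup>2)"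
      by (simp add: A_def D_def power2_eq_square algebra_simps)
    also have "\<dots> = (c0 * c2 + \<gamma> * c1 * c3)\<^sup>2 + \<gamma> * (c0 * c3 + c1 * c2)\<^sup>2"
      by (simp only: add_square_char2[OF char2])
    finally have "\<alpha> = ((c0 * c2 + \<gamma> * c1 * c3) / D)\<^sup>2 + \<gamma> * ((c0 * c3 + c1 * c2) / D)\<^sup>2"
      using \<open>D \<noteq> 0\<close> by (simp add: power_divide nonzero_eq_divide_eq add_divide_distrib[symmetric])
    then show False
      using \<alpha> by blast
  qed
  then have "A = 0"
    using AD by simp
  show ?thesis
    using quadratic[of c0 c1] quadratic[of c2 c3] \<open>A = 0\<close> \<open>D = 0\<close> by (simp add: A_def D_def)
qed

lemma Root_difference_quadratic:
  fixes \<alpha> \<beta> :: "'a::field"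
  assumes "CHAR('a) = 2"
  shows "{y - z | y z. y \<in> Root [:- \<alpha>, 0, 1:] \<and> z \<in> Root [:- \<beta>, 0, 1:]} =
    {x. x\<^sup>2 = to_ac (\<alpha> + \<beta>)}" (is "?L = ?R")
proof -
  have char2: "CHAR('a alg_closure) = 2"
    by (simp add: assms)
  have diff: "y - z = y + z" for y z :: "'a alg_closure"
    by (simp only: diff_conv_add_uminus neg_char2[OF char2])
  show ?thesis
  proof (rule equalityI; rule subsetI)
    fix x
    assume "x \<in> ?L"
    then show "x \<in> ?R"
      by (auto simp: Root_quadratic diff add_square_char2[OF char2])
  next
    fix x
    assume "x \<in> ?R"
    then have x: "x\<^sup>2 = to_ac \<alpha> + to_ac \<beta>" by simp
    obtain y z where y: "y\<^sup>2 = to_ac \<alpha>" and z: "z\<^sup>2 = to_ac \<beta>"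
      using nth_root_exists[of 2 "to_ac \<alpha>"] nth_root_exists[of 2 "to_ac \<beta>"] by auto
    have "(x - (y - z))\<^sup>2 = 0"
      by (simp only: diff add_square_char2[OF char2] x y z add_self_char2[OF char2])
    then have "x = y - z" by simp
    then show "x \<in> ?L"
      using y z by (auto simp: Root_quadratic)
  qed
qed

lemma poly_endo_quadratic_eq_0_iff:
  assumes "vector_space scale" "Vector_Spaces.linear scale scale a"
  shows "poly_endo scale [:- \<alpha>, 0, 1:] a = (\<lambda>v. 0) \<longleftrightarrow> (\<forall>x. a (a x) = scale \<alpha> x)"
proof -
  interpret linear_endo scale a
    using assms by (simp add: linear_endo_def linear_endo_axioms_def)
  have "act [:- \<alpha>, 0, 1:] x = a (a x) - scale \<alpha> x" for x
    by (simp add: act_pCons endo.zero)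
  then show ?thesis
    by (simp add: fun_eq_iff)
qed

section \<open>Differences in terms of a single square root\<close>

context char2_endo
begin

lemma act_P: "act P x = u (u x) - scale \<gamma> x"
  by (simp add: P act_pCons endo.zero)

lemma paired_nilpotent:
  assumes "paired m n v"
  shows "act (P ^ (\<Sum>i<m. n i)) x = 0"
proof -
  \<comment> \<open>The sum bounds every exponent and is meaningful also for m = 0.\<close>
  let ?N = "\<Sum>i<m. n i"
  have dec: "cyclic_decomposition {..<2 * m} v (\<lambda>k. P ^ n (k div 2))"
    using assms by (simp add: paired_def)
  have zero: "act (P ^ ?N) (v k) = 0" if "k < 2 * m" for k
  proof -
    have "n (k div 2) \<le> ?N"
      using that by (intro member_le_sum) auto
    then have "P ^ n (k div 2) dvd P ^ ?N"
      by (rule le_imp_power_dvd)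
    moreover have "act (P ^ n (k div 2)) (v k) = 0"
      using dec that by (simp add: cyclic_decomposition_def)
    ultimately show ?thesis
      by (rule act_dvd_eq_0)
  qed
  obtain f where x: "x = (\<Sum>k<2 * m. act (f k) (v k))"
    using dec unfolding cyclic_decomposition_def by blast
  have "act (P ^ ?N) x = (\<Sum>k<2 * m. act (f k) (act (P ^ ?N) (v k)))"
    by (simp only: x act_sum_right act_commute[of "P ^ ?N"])
  also have "\<dots> = 0"
    by (simp add: zero)
  finally show ?thesis .
qed

text \<open>\<open>b\<close> has to be a - u, and b^2 = a^2 - (a u + u a) + u^2 equals \<beta>
  exactly when a u + u a = P(u), as signs do not matter in characteristic 2.\<close>

lemma pq_difference_iff_twist:
  assumes \<gamma>: "\<gamma> = \<alpha> + \<beta>"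
  shows "pq_difference scale [:- \<alpha>, 0, 1:] [:- \<beta>, 0, 1:] u \<longleftrightarrow>
    (\<exists>a. Vector_Spaces.linear scale scale a \<and> (\<forall>x. a (a x) = scale \<alpha> x) \<and>
      (\<forall>x. a (u x) + u (a x) = act P x))"
proof
  assume "pq_difference scale [:- \<alpha>, 0, 1:] [:- \<beta>, 0, 1:] u"
  then obtain a b where a: "Vector_Spaces.linear scale scale a" and b: "Vector_Spaces.linear scale scale b"
    and "poly_endo scale [:- \<alpha>, 0, 1:] a = (\<lambda>v. 0)" "poly_endo scale [:- \<beta>, 0, 1:] b = (\<lambda>v. 0)"
    and u: "\<And>v. u v = a v - b v"
    by (auto simp: pq_difference_def)
  then have aa: "a (a x) = scale \<alpha> x" and bb: "b (b x) = scale \<beta> x" for x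
    using poly_endo_quadratic_eq_0_iff[OF vector_space_axioms] by blast+
  interpret a: Vector_Spaces.linear scale scale a by fact
  interpret b: Vector_Spaces.linear scale scale b by fact
  have "a (u x) + u (a x) = act P x" for x
  proof -
    have "a (u x) + u (a x) = (scale \<alpha> x + scale \<alpha> x) - (a (b x) + b (a x))"
      unfolding u a.diff aa by (simp add: algebra_simps del: add_self_vector)
    also have "\<dots> = act P x"
      unfolding act_P u a.diff b.diff aa bb \<gamma> add_self_vector
      by (simp add: algebra_simps scale_left_distrib)
    finally show ?thesis .
  qed
  with a aa show "\<exists>a. Vector_Spaces.linear scale scale a \<and> (\<forall>x. a (a x) = scale \<alpha> x) \<and>
      (\<forall>x. a (u x) + u (a x) = act P x)"
    by blast
next
  assume "\<exists>a. Vector_Spaces.linear scale scale a \<and> (\<forall>x. a (a x) = scale \<alpha> x) \<and>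
      (\<forall>x. a (u x) + u (a x) = act P x)"
  then obtain a where a: "Vector_Spaces.linear scale scale a" and aa: "\<And>x. a (a x) = scale \<alpha> x"
    and au: "\<And>x. a (u x) + u (a x) = act P x"
    by blast
  interpret a: Vector_Spaces.linear scale scale a by fact
  define b where "b x = a x - u x" for x
  have b: "Vector_Spaces.linear scale scale b"
    by (intro Vector_Spaces.linear.intro module_hom.intro module_hom_axioms.intro
        vector_space_axioms module_axioms)
      (simp_all add: b_def a.add a.scale endo.add endo.scale scale_right_diff_distrib)
  have bb: "b (b x) = scale \<beta> x" for x
  proof -
    have "b (b x) = scale \<alpha> x - (a (u x) + u (a x)) + u (u x)"
      by (simp add: b_def a.diff endo.diff aa)
    also have "\<dots> = (scale \<alpha> x + scale \<alpha> x) + scale \<beta> x"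
      unfolding au act_P \<gamma> by (simp add: scale_left_distrib algebra_simps del: add_self_vector)
    finally show ?thesis
      unfolding add_self_vector by simp
  qed
  show "pq_difference scale [:- \<alpha>, 0, 1:] [:- \<beta>, 0, 1:] u"
    unfolding pq_difference_def
  proof (intro exI conjI)
    show "Vector_Spaces.linear scale scale a" "Vector_Spaces.linear scale scale b"
      by (fact a b)+
    show "poly_endo scale [:- \<alpha>, 0, 1:] a = (\<lambda>v. 0)" "poly_endo scale [:- \<beta>, 0, 1:] b = (\<lambda>v. 0)"
      using poly_endo_quadratic_eq_0_iff[OF vector_space_axioms] a b aa bb by blast+
    show "u = (\<lambda>v. a v - b v)"
      by (simp add: b_def fun_eq_iff)
  qed
qed

end

theorem theorem3p30:
  fixes scale :: "'a::field \<Rightarrow> 'b::ab_group_add \<Rightarrow> 'b"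
    and Basis :: "'b set"
    and u :: "'b \<Rightarrow> 'b"
    and \<alpha> \<beta> :: 'a
    and p q P :: "'a poly"
  assumes "CHAR('a) = 2"
    and "p = [:-\<alpha>, 0, 1:]" and "q = [:-\<beta>, 0, 1:]"
    and "Factorial_Ring.irreducible p" and "Factorial_Ring.irreducible q"
    and "splitting_field p \<noteq> splitting_field q"
    and "finite_dimensional_vector_space scale Basis"
    and "Vector_Spaces.linear scale scale u"
    and "P = [:-\<alpha> - \<beta>, 0, 1:]"
  defines "cond_i \<equiv> pq_difference scale p q u \<and> d_exceptional scale p q u"
    and "cond_ii \<equiv> (\<exists>r. invariant_factors scale u r \<and> (\<forall>k\<ge>1. \<exists>n. r k = P ^ n) \<and>
            (\<forall>k\<ge>1. r (2 * k - 1) = r (2 * k)))"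
    and "cond_iii \<equiv> (\<exists>ns bs. (\<forall>n\<in>set ns. n > 0) \<and>
            represents scale u bs
              (diag_block_mat (map (\<lambda>n. diag_block_mat [companion (P ^ n), companion (P ^ n)]) ns)))"
  shows "(cond_i \<longleftrightarrow> cond_ii) \<and> (cond_ii \<longleftrightarrow> cond_iii)"
proof -
  interpret finite_dimensional_vector_space scale Basis by fact
  interpret char2_endo scale u "\<alpha> + \<beta>" P
  proof (intro char2_endo.intro linear_endo.intro linear_endo_axioms.intro char2_endo_axioms.intro)
    show "P = [:- (\<alpha> + \<beta>), 0, 1:]"
      by (simp add: assms(9))
  qed (fact vector_space_axioms assms(8) assms(1))+
  have B: "finite Basis" "span Basis = UNIV"
    by (fact finite_Basis span_Basis)+
  have exceptional: "d_exceptional scale p q u \<longleftrightarrow>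
      (\<forall>bs M x. represents scale u bs M \<longrightarrow> eigenvalue (map_mat to_ac M) x \<longrightarrow>
        x\<^sup>2 = to_ac (\<alpha> + \<beta>))"
    unfolding d_exceptional_def ac_eigenvalue_def assms(2,3)
      Root_difference_quadratic[OF assms(1)] by blast
  have difference: "pq_difference scale p q u \<longleftrightarrow>
      (\<exists>a. Vector_Spaces.linear scale scale a \<and> (\<forall>x. a (a x) = scale \<alpha> x) \<and>
        (\<forall>x. a (u x) + u (a x) = act P x))"
    unfolding assms(2,3) by (rule pq_difference_iff_twist) simp
  have "cond_i \<longleftrightarrow> (\<exists>m n v. paired m n v)"
  proof
    assume cond_i
    then obtain a where a: "Vector_Spaces.linear scale scale a" "\<And>x. a (a x) = scale \<alpha> x"
      "\<And>x. a (u x) + u (a x) = act P x"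
      unfolding cond_i_def difference by blast
    \<comment> \<open>Irreducibility of p and q and the distinctness of their splitting fields enter
      here, as anisotropy of the form in \<open>norm_eq_0\<close>.\<close>
    interpret twisted_endo scale u "\<alpha> + \<beta>" P a \<alpha>
      by (intro twisted_endo.intro twisted_endo_axioms.intro char2_endo_axioms a
          biquadratic_norm_eq_0[OF assms(1,4,5,6)[unfolded assms(2,3)]])
    obtain N where "\<And>x. act (P ^ N) x = 0"
      using nilpotent_if_eigenvalues[OF B] \<open>cond_i\<close> unfolding cond_i_def exceptional by metis
    then show "\<exists>m n v. paired m n v"
      unfolding paired_def by (rule paired_decomposition_exists[OF B])
  next
    assume "\<exists>m n v. paired m n v"
    then obtain m n v where "paired m n v" by blast
    then have "pq_difference scale p q u"
      unfolding difference by (rule paired_imp_twist)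
    moreover have "d_exceptional scale p q u"
      unfolding exceptional
      using eigenvalue_square[OF _ _ paired_nilpotent[OF \<open>paired m n v\<close>]] by blast
    ultimately show cond_i
      by (simp add: cond_i_def)
  qed
  then show ?thesis
    unfolding cond_ii_def cond_iii_def
    using paired_iff_invariant_factors paired_iff_represents by simp
qed

end
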